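(* Let $\Gamma$ be a bipartite distance-balanced graph for which there exists a $2$-cut $\{a,b\}$ with $d(a,b)=3$. Then either $\Gamma$ is a cycle, or there exist an integer $m\ge 2$ and an odd integer $\ell\ge 3$ such that $\Gamma$ is isomorphic to $W(m,\ell)$.
   Context: All graphs are finite, simple, undirected, connected; $d$ denotes distance. For $u,v$ let $W_{uv}=\{z: d(u,z)<d(v,z)\}$; a connected graph is distance-balanced if $|W_{uv}|=|W_{vu}|$ for all adjacent $u,v$. A $2$-cut is a set of two vertices whose removal disconnects the graph. For $m\ge2$, $\ell\ge3$ and $0\le i\le 4\ell-1$ let $f(i)=1$ if $i\equiv 0$ or $3\pmod 4$ and $f(i)=m$ otherwise; $W(m,\ell)$ is the graph with vertex set $\{(i,j):0\le i\le 4\ell-1,\ 1\le j\le f(i)\}$ in which $(i_1,j_1)\sim(i_2,j_2)$ iff $i_2-i_1\equiv\pm1\pmod{4\ell}$. *)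

theory Defs
  imports "Graph_Theory.Graph_Theory" "HOL-Number_Theory.Cong"
begin

text \<open>
  Finite simple undirected graphs are represented by the locale predicate \<^const>\<open>graph\<close>:
  finite symmetric digraphs without loops and parallel arcs. The relation
  \<^const>\<open>dominates\<close> is then adjacency.
\<close>

text \<open>The distance is the infimum of the walk costs for unit arc weights.\<close>

definition gdist :: "('a, 'b) pre_digraph \<Rightarrow> 'a \<Rightarrow> 'a \<Rightarrow> ereal" where
  "gdist G u v = wf_digraph.\<mu> G (\<lambda>_. 1) u v"

definition closer_set :: "('a, 'b) pre_digraph \<Rightarrow> 'a \<Rightarrow> 'a \<Rightarrow> 'a set" where
  "closer_set G u v = {z \<in> verts G. gdist G u z < gdist G v z}"

definition distance_balanced :: "('a, 'b) pre_digraph \<Rightarrow> bool" where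
  "distance_balanced G \<longleftrightarrow>
     Digraph_Component.connected G \<and>
     (\<forall>u v. u \<rightarrow>\<^bsub>G\<^esub> v \<longrightarrow> card (closer_set G u v) = card (closer_set G v u))"

definition bipartite :: "('a, 'b) pre_digraph \<Rightarrow> bool" where
  "bipartite G \<longleftrightarrow>
     (\<exists>X Y. verts G = X \<union> Y \<and> X \<inter> Y = {} \<and> arcs_ends G \<subseteq> X \<times> Y \<union> Y \<times> X)"

text \<open>
  The null graph does not count as connected in the library, so non-emptiness of the
  remaining vertex set has to be demanded separately.
\<close>

definition two_cut :: "('a, 'b) pre_digraph \<Rightarrow> 'a set \<Rightarrow> bool" where
  "two_cut G S \<longleftrightarrow>
     S \<subseteq> verts G \<and> card S = 2 \<and> verts G - S \<noteq> {} \<and>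
     \<not> Digraph_Component.connected (G \<restriction> (verts G - S))"

definition cycle_graph :: "nat \<Rightarrow> nat pair_pre_digraph" where
  "cycle_graph n =
     \<lparr> pverts = {0..<n},
       parcs = {(i, j). i < n \<and> j < n \<and>
         ([int j - int i = 1] (mod int n) \<or> [int j - int i = -1] (mod int n))} \<rparr>"

definition is_cycle_graph :: "('a, 'b) pre_digraph \<Rightarrow> bool" where
  "is_cycle_graph G \<longleftrightarrow> (\<exists>n\<ge>3. digraph_iso G (with_proj (cycle_graph n)))"

definition W_layer :: "nat \<Rightarrow> nat \<Rightarrow> nat" where
  "W_layer m i = (if [i = 0] (mod 4) \<or> [i = 3] (mod 4) then 1 else m)"

definition W_verts :: "nat \<Rightarrow> nat \<Rightarrow> (nat \<times> nat) set" where
  "W_verts m l = {(i, j). i < 4 * l \<and> 1 \<le> j \<and> j \<le> W_layer m i}"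

definition W_graph :: "nat \<Rightarrow> nat \<Rightarrow> (nat \<times> nat) pair_pre_digraph" where
  "W_graph m l =
     \<lparr> pverts = W_verts m l,
       parcs = {((i1, j1), (i2, j2)). (i1, j1) \<in> W_verts m l \<and> (i2, j2) \<in> W_verts m l \<and>
         ([int i2 - int i1 = 1] (mod int (4 * l)) \<or> [int i2 - int i1 = -1] (mod int (4 * l)))} \<rparr>"

lemma gdist_eq_Least_length:
  assumes "wf_digraph G" and "u \<rightarrow>\<^sup>*\<^bsub>G\<^esub> v"
  shows "gdist G u v = ereal (real (LEAST n. \<exists>p. pre_digraph.awalk G u p v \<and> length p = n))"
proof -
  interpret wf_digraph G by fact
  let ?P = "\<lambda>n. \<exists>p. awalk u p v \<and> length p = n"
  have cost: "awalk_cost (\<lambda>_. 1) p = real (length p)" for p :: "'b list"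
    by (induction p) auto
  obtain q where "awalk u q v" using assms(2) by (auto simp: reachable_awalk)
  then have "?P (length q)" by blast
  then have "?P (LEAST n. ?P n)" by (rule LeastI)
  then obtain p where p: "awalk u p v" "length p = (LEAST n. ?P n)" by blast
  have le: "(LEAST n. ?P n) \<le> length q" if "awalk u q v" for q
    using that by (intro Least_le) blast
  have "(INF p\<in>{p. awalk u p v}. ereal (awalk_cost (\<lambda>_. 1) p)) = ereal (real (LEAST n. ?P n))"
  proof (rule INF_eqI)
    fix i assume "i \<in> {p. awalk u p v}"
    then show "ereal (real (LEAST n. ?P n)) \<le> ereal (awalk_cost (\<lambda>_. 1) i)"
      using le by (simp add: cost)
  next
    fix y assume "\<And>i. i \<in> {p. awalk u p v} \<Longrightarrow> y \<le> ereal (awalk_cost (\<lambda>_. 1) i)"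
    from this[of p] show "y \<le> ereal (real (LEAST n. ?P n))"
      using p by (simp add: cost)
  qed
  then show ?thesis by (simp add: gdist_def \<mu>_def)
qed

lemma cong_diff_swap_iff:
  "[int a - int b = - 1] (mod n) \<longleftrightarrow> [int b - int a = 1] (mod n)"
  using cong_minus_minus_iff[of "int b - int a" 1 n] by simp

lemma graph_cycle_graph:
  assumes "n \<ge> 2"
  shows "graph (with_proj (cycle_graph n))"
proof -
  have fin: "finite (parcs (cycle_graph n))"
    by (rule finite_subset[of _ "{0..<n} \<times> {0..<n}"]) (auto simp: cycle_graph_def)
  have "\<not> [0 = 1] (mod int n)"
    using assms by (auto simp: cong_def)
  then have "pair_graph (cycle_graph n)"
    using fin
    by unfold_locales
       (auto simp: cycle_graph_def symmetric_def sym_def cong_diff_swap_iff)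
  then show ?thesis by (rule pair_graph.pair_graphD_graph)
qed

lemma graph_W_graph:
  assumes "l \<ge> 1"
  shows "graph (with_proj (W_graph m l))"
proof -
  have fv: "finite (W_verts m l)"
    by (rule finite_subset[of _ "{0..<4 * l} \<times> {0..max 1 m}"])
       (auto simp: W_verts_def W_layer_def split: if_splits)
  have fin: "finite (parcs (W_graph m l))"
    by (rule finite_subset[of _ "W_verts m l \<times> W_verts m l"])
       (auto simp: W_graph_def fv)
  have "\<not> [0 = 1] (mod int (4 * l))"
    using assms by (auto simp: cong_def)
  then have "pair_graph (W_graph m l)"
    using fin fv
    by unfold_locales
       (auto simp: W_graph_def symmetric_def sym_def cong_diff_swap_iff)
  then show ?thesis by (rule pair_graph.pair_graphD_graph)
qed

end

theory Submission
  imports Defs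
begin

text \<open>
  In a bipartite distance-balanced graph on \<open>n\<close> vertices every \<open>W\<^sub>u\<^sub>v\<close> has \<open>n/2\<close> elements. Let \<open>{a, b}\<close> be
  a 2-cut at distance 3. Counting \<open>W\<^sub>u\<^sub>v\<close> for edges on the smaller side \<open>D\<close> of the cut shows that no edge
  inside \<open>D\<close> moves away from both \<open>a\<close> and \<open>b\<close>; hence \<open>D\<close> consists of neighbours of \<open>a\<close> and neighbours of \<open>b\<close>,
  which form a complete bipartite graph with equal parts of size \<open>m\<close>. On the other side there is
  exactly one edge \<open>xy\<close> joining the vertices closer to \<open>b\<close> to those closer to \<open>a\<close>, and by the same count all
  vertices of the first kind lie on geodesics from \<open>b\<close> to \<open>x\<close>, all of the second on geodesics from \<open>a\<close> to \<open>y\<close>.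
  The edge conditions along these two segments become a linear recursion between their level sizes,
  perturbed by nonnegative terms measuring how far each segment is from having complete bipartite
  graphs between consecutive levels. The perturbations vanish and the level sizes repeat with
  period 4 as \<open>1, 1, m, m\<close> and \<open>1, m, m, 1\<close>, so the graph is a cycle if \<open>m = 1\<close> and \<open>W(m, l)\<close> otherwise.
\<close>

text \<open>The obstacle is that inside a long segment the edges between consecutive levels form an
  a priori arbitrary relation, so counting \<open>W\<^sub>u\<^sub>v\<close> for an edge of the
  segment determines level sizes only up to an unknown error. To control it, each distance is
  compared with the value it would have if consecutive levels were completely joined. The sum of the
  differences from one vertex, its excess, is constant on levels, because its change along an edge
  is a count that depends on the level only. The counts for one segment involve the level sizes of
  the other, so both have to be solved together. Nonnegativity of the excess and positivity of the
  sizes settle most values, but once per period in each segment a size and an excess could still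
  trade off against each other; there \<open>level_collapse\<close>, an argument on distances and
  not on numbers, rules out positive excess. The circle has \<open>2 * k + 4\<close> positions,
  where \<open>k\<close> is the length of a segment. For \<open>m\<close> different from 1 the
  pattern can close up only if 4 divides \<open>k\<close>, so the circumference is 4 modulo 8; this
  is why the second parameter of the graph is odd.\<close>

locale balanced_metric =
  fixes V :: "'a set" and adj :: "'a \<Rightarrow> 'a \<Rightarrow> bool" and d :: "'a \<Rightarrow> 'a \<Rightarrow> nat"
  assumes finite_V: "finite V"
    and adj_V: "adj u v \<Longrightarrow> u \<in> V \<and> v \<in> V"
    and d_eq_0: "u \<in> V \<Longrightarrow> v \<in> V \<Longrightarrow> d u v = 0 \<longleftrightarrow> u = v"
    and d_sym: "u \<in> V \<Longrightarrow> v \<in> V \<Longrightarrow> d u v = d v u"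
    and d_triangle: "u \<in> V \<Longrightarrow> v \<in> V \<Longrightarrow> w \<in> V \<Longrightarrow> d u w \<le> d u v + d v w"
    and d_eq_1: "u \<in> V \<Longrightarrow> v \<in> V \<Longrightarrow> d u v = 1 \<longleftrightarrow> adj u v"
    and d_step: "u \<in> V \<Longrightarrow> v \<in> V \<Longrightarrow> u \<noteq> v \<Longrightarrow> \<exists>w. adj u w \<and> d u v = Suc (d w v)"
    and d_adj_neq: "adj u v \<Longrightarrow> z \<in> V \<Longrightarrow> d u z \<noteq> d v z"
    and balanced: "adj u v \<Longrightarrow> card {z \<in> V. d u z < d v z} = card {z \<in> V. d v z < d u z}"
begin

lemma adj_sym: "adj u v \<Longrightarrow> adj v u"
  by (metis adj_V d_eq_1 d_sym)

lemma adj_d: "adj u v \<Longrightarrow> d u v = 1"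
  by (meson adj_V d_eq_1)

lemma adj_cases:
  assumes "adj u v" "z \<in> V"
  obtains "d u z = Suc (d v z)" | "d v z = Suc (d u z)"
proof -
  have "u \<in> V" "v \<in> V" using adj_V assms by blast+
  have "d u z \<le> 1 + d v z" using d_triangle[of u v z] adj_d assms \<open>u \<in> V\<close> \<open>v \<in> V\<close> by simp
  moreover have "d v z \<le> 1 + d u z"
    using d_triangle[of v u z] adj_d[OF adj_sym] assms \<open>u \<in> V\<close> \<open>v \<in> V\<close> by simp
  ultimately show ?thesis using d_adj_neq[OF assms] that by linarith
qed

lemma card_closer:
  assumes "adj u v"
  shows "2 * card {z \<in> V. d u z < d v z} = card V"
proof -
  have "V = {z \<in> V. d u z < d v z} \<union> {z \<in> V. d v z < d u z}"
    using d_adj_neq[OF assms] by (auto simp: neq_iff)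
  then have "card V = card ({z \<in> V. d u z < d v z} \<union> {z \<in> V. d v z < d u z})" by argo
  also have "\<dots> = card {z \<in> V. d u z < d v z} + card {z \<in> V. d v z < d u z}"
    using finite_V by (intro card_Un_disjoint) auto
  finally show ?thesis using balanced[OF assms] by simp
qed

lemma card_le_if_closer_subset:
  assumes "adj u v" "{z \<in> V. d u z < d v z} \<subseteq> C" "finite C"
  shows "card V \<le> 2 * card C"
  using card_closer[OF assms(1)] card_mono[OF assms(3,2)] by linarith

lemma card_ge_if_subset_closer:
  assumes "adj u v" "C \<subseteq> V" "\<And>z. z \<in> C \<Longrightarrow> d u z < d v z"
  shows "2 * card C \<le> card V"
proof -
  have "card C \<le> card {z \<in> V. d u z < d v z}"
    using assms finite_V by (intro card_mono) auto
  then show ?thesis using card_closer[OF assms(1)] by linarith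
qed

text \<open>Follow a geodesic from \<open>u\<close> to \<open>z\<close>: its first vertex outside
  \<open>C\<close> lies in \<open>S\<close>, because \<open>C\<close> has no other exits. The target
  \<open>z\<close> may itself belong to \<open>S\<close>.\<close>

lemma d_via_separator:
  assumes "\<And>x y. x \<in> C \<Longrightarrow> adj x y \<Longrightarrow> y \<in> C \<union> S" "C \<union> S \<subseteq> V" "u \<in> C" "z \<in> V - C"
  shows "\<exists>s\<in>S. d u z = d u s + d s z"
  using \<open>u \<in> C\<close>
proof (induction "d u z" arbitrary: u)
  case 0
  then show ?case using d_eq_0[of u z] assms by auto
next
  case (Suc n)
  have "u \<in> V" "z \<in> V" "u \<noteq> z" using assms Suc by auto
  then obtain w where w: "adj u w" "d u z = Suc (d w z)" using d_step by blast
  show ?case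
  proof (cases "w \<in> S")
    case True
    then show ?thesis using w adj_d[OF w(1)] by (intro bexI[of _ w]) auto
  next
    case False
    then have "w \<in> C" using assms(1) Suc w by blast
    then obtain s where s: "s \<in> S" "d w z = d w s + d s z" using Suc w by fastforce
    have *: "d u s \<le> 1 + d w s"
      using d_triangle[of u w s] adj_d w adj_V s assms(2) by fastforce
    have "d u z \<le> d u s + d s z"
      using d_triangle \<open>u \<in> V\<close> \<open>z \<in> V\<close> s assms(2) by blast
    then show ?thesis using * s w by (intro bexI[of _ s]) auto
  qed
qed

text \<open>There is no cut vertex: each part that a cut vertex \<open>a\<close> splits off contains \<open>W\<^sub>q\<^sub>a\<close> for a neighbour \<open>q\<close> of
  \<open>a\<close> in it, hence at least half of all vertices.\<close>

lemma exit_both: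
  assumes C: "C \<noteq> {}" "C \<subseteq> V - {a, b}" "\<And>x y. x \<in> C \<Longrightarrow> adj x y \<Longrightarrow> y \<in> C \<union> {a, b}"
    and ab: "a \<in> V" "b \<in> V" "a \<noteq> b"
  shows "\<exists>v\<in>C. adj v b"
proof (rule ccontr)
  assume n: "\<not> ?thesis"
  have C1: "\<And>x y. x \<in> C \<Longrightarrow> adj x y \<Longrightarrow> y \<in> C \<union> {a}" using C(3) n by blast
  have half: "card V \<le> 2 * card K" if K: "K \<noteq> {}" "K \<subseteq> V - {a}"
    "\<And>x y. x \<in> K \<Longrightarrow> adj x y \<Longrightarrow> y \<in> K \<union> {a}" for K
  proof -
    obtain p where p: "p \<in> K" using K(1) by blast
    have fin: "finite K" using K(2) finite_V finite_subset by blast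
    have "\<exists>q\<in>K. adj q a"
    proof (rule ccontr)
      assume "\<not> ?thesis"
      then have "\<And>x y. x \<in> K \<Longrightarrow> adj x y \<Longrightarrow> y \<in> K \<union> {}" using K(3) by blast
      then have "\<exists>s\<in>{}. d p a = d p s + d s a"
        using K(2) ab p by (intro d_via_separator[of K]) auto
      then show False by blast
    qed
    then obtain q where q: "q \<in> K" "adj q a" by blast
    have "{z \<in> V. d q z < d a z} \<subseteq> K"
    proof
      fix z assume z: "z \<in> {z \<in> V. d q z < d a z}"
      show "z \<in> K"
      proof (rule ccontr)
        assume "z \<notin> K"
        then have "\<exists>s\<in>{a}. d q z = d q s + d s z"
          using K q z ab by (intro d_via_separator[of K]) auto
        then show False using z by simp
      qed
    qed
    then show ?thesis using card_le_if_closer_subset[OF q(2) _ fin] by blast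
  qed
  let ?K = "V - {a} - C"
  have "card V \<le> 2 * card C" by (rule half) (use C(1,2) C1 in blast)+
  moreover have "card V \<le> 2 * card ?K"
  proof (rule half)
    show "?K \<noteq> {}" using ab C(2) by blast
    fix x y assume "x \<in> ?K" "adj x y"
    then show "y \<in> ?K \<union> {a}" using C1[of y x] adj_sym adj_V[of x y] by blast
  qed auto
  moreover have "card V = 1 + card C + card ?K"
  proof -
    have fC: "finite C" using C(2) finite_V finite_subset by blast
    have "card ?K = card (V - {a}) - card C" using C(2) fC by (intro card_Diff_subset) auto
    moreover have "card C \<le> card (V - {a})" using C(2) finite_V by (intro card_mono) auto
    moreover have "card V = 1 + card (V - {a})" using card_Suc_Diff1[OF finite_V ab(1)] by simp
    ultimately show ?thesis by linarith
  qed
  ultimately show False by linarith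
qed

end

section \<open>The small side of the cut and the first counts\<close>

text \<open>The inequality \<open>large_E\<close> amounts to \<open>card D \<le> card E\<close>. By
  bipartiteness and \<open>d a b = 3\<close>, a neighbour of one cut vertex has distance 2 or 4 from
  the other; \<open>short_a\<close> and \<open>short_b\<close> exclude 4 on the side
  \<open>D\<close>.\<close>

locale short_cut =
  balanced_metric +
  fixes a b :: 'a and D E :: "'a set"
  assumes V_eq: "V = {a, b} \<union> D \<union> E"
    and disj: "D \<inter> E = {}" "a \<notin> D" "b \<notin> D" "a \<notin> E" "b \<notin> E"
    and no_DE: "u \<in> D \<Longrightarrow> v \<in> E \<Longrightarrow> \<not> adj u v"
    and nonempty: "D \<noteq> {}" "E \<noteq> {}"
    and d_ab: "d a b = 3"
    and short_a: "u \<in> D \<Longrightarrow> adj u a \<Longrightarrow> d u b = 2"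
    and short_b: "u \<in> D \<Longrightarrow> adj u b \<Longrightarrow> d u a = 2"
    and large_E: "card V \<le> 2 * card E + 2"
begin

text \<open>All hypotheses are symmetric in \<open>a\<close> and \<open>b\<close>, so statements
  about \<open>A\<close>, \<open>Ea\<close> and their counterparts \<open>B\<close>,
  \<open>Eb\<close> need only one proof.\<close>

lemma swap: "short_cut V adj d b a D E"
  using V_eq disj no_DE nonempty d_ab short_a short_b large_E d_sym[of a b]
  by unfold_locales auto

lemma ab: "a \<in> V" "b \<in> V" "a \<noteq> b" "D \<subseteq> V" "E \<subseteq> V" "finite D" "finite E"
  using V_eq d_ab d_eq_0[of a b] finite_V by (auto intro: finite_subset)

lemma D_closed: "x \<in> D \<Longrightarrow> adj x y \<Longrightarrow> y \<in> D \<union> {a, b}"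
  using V_eq no_DE adj_V[of x y] by blast

lemma E_closed: "x \<in> E \<Longrightarrow> adj x y \<Longrightarrow> y \<in> E \<union> {a, b}"
  using V_eq no_DE[of y x] adj_V[of x y] adj_sym[of x y] by blast

lemma d_D_E:
  assumes "u \<in> D" "z \<in> E"
  shows "d u z = min (d u a + d a z) (d u b + d b z)"
proof -
  have "\<exists>s\<in>{a, b}. d u z = d u s + d s z"
    using D_closed assms ab disj by (intro d_via_separator[of D]) auto
  moreover have "d u z \<le> d u a + d a z" "d u z \<le> d u b + d b z"
    using d_triangle assms ab by blast+
  ultimately show ?thesis by auto
qed

text \<open>Geodesics from \<open>D\<close> to \<open>E\<close> leave through \<open>a\<close> or
  \<open>b\<close>. So \<open>E\<close>, \<open>a\<close>, \<open>b\<close> and \<open>x\<close>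
  would all be closer to \<open>x\<close> than to \<open>y\<close>; these are
  \<open>card E + 3\<close> vertices, whereas half of \<open>V\<close> is at most
  \<open>card E + 1\<close>.\<close>

lemma D_no_both_farther:
  assumes "x \<in> D" "y \<in> D" "adj x y"
  shows "\<not> (d x a < d y a \<and> d x b < d y b)"
proof
  assume f: "d x a < d y a \<and> d x b < d y b"
  have "2 * card (E \<union> {a, b, x}) \<le> card V"
  proof (rule card_ge_if_subset_closer[OF assms(3)])
    show "E \<union> {a, b, x} \<subseteq> V" using ab assms by auto
    fix z assume "z \<in> E \<union> {a, b, x}"
    then consider "z \<in> E" | "z = a" | "z = b" | "z = x" by blast
    then show "d x z < d y z"
    proof cases
      case 1
      then show ?thesis using f by (auto simp: d_D_E assms min_def)
    next
      case 4
      then have "d x z = 0" "d y z \<noteq> 0"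
        using d_eq_0 adj_V[OF assms(3)] d_adj_neq[OF assms(3), of x] by auto
      then show ?thesis by simp
    qed (use f in auto)
  qed
  moreover have "card (E \<union> {a, b, x}) = card E + 3"
    using disj assms ab by (subst card_Un_disjoint) (auto simp: card_insert_if)
  ultimately show False using large_E by linarith
qed

text \<open>Along an edge inside \<open>D\<close> the distances to \<open>a\<close> and
  \<open>b\<close> change in opposite directions, so their sum is constant. The vertices with a sum
  other than 3 then have no exits except \<open>a\<close> and \<open>b\<close>, and
  \<open>exit_both\<close> finds one adjacent to \<open>b\<close>; but there \<open>short_b\<close>
  gives 2 + 1.\<close>

lemma D_sum:
  assumes "x \<in> D"
  shows "d x a + d x b = 3"
proof (rule ccontr)
  assume n: "d x a + d x b \<noteq> 3"
  let ?C = "{x \<in> D. d x a + d x b \<noteq> 3}"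
  have "\<exists>v\<in>?C. adj v b"
  proof (rule exit_both)
    show "?C \<noteq> {}" using n assms by blast
    fix p q assume p: "p \<in> ?C" and pq: "adj p q"
    show "q \<in> ?C \<union> {a, b}"
    proof (cases "q \<in> D")
      case True
      have "d p a + d p b = d q a + d q b"
        by (rule adj_cases[OF pq ab(1)]; rule adj_cases[OF pq ab(2)])
          (use True p pq adj_sym D_no_both_farther[of p q] D_no_both_farther[of q p] in auto)
      then show ?thesis using p True by simp
    qed (use D_closed p pq in blast)
  qed (use ab disj in auto)
  then show False using short_b adj_d by fastforce
qed

definition "A = {x \<in> D. adj x a}"
definition "B = {x \<in> D. adj x b}"
definition "Ea = {z \<in> E. d z a < d z b}"
definition "Eb = {z \<in> E. d z b < d z a}"

lemma swap_defs:
  "short_cut.A adj b D = B" "short_cut.B adj a D = A" "short_cut.Ea d b a E = Eb" "short_cut.Eb d b a E = Ea"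
  by (simp_all add: A_def B_def Ea_def Eb_def short_cut.A_def[OF swap] short_cut.B_def[OF swap]
      short_cut.Ea_def[OF swap] short_cut.Eb_def[OF swap])

lemma A_d: "x \<in> A \<Longrightarrow> d x a = 1 \<and> d x b = 2"
  using adj_d short_a by (auto simp: A_def)

lemma B_d: "x \<in> B \<Longrightarrow> d x b = 1 \<and> d x a = 2"
  using adj_d short_b by (auto simp: B_def)

lemma AB: "A \<union> B = D" "A \<inter> B = {}" "A \<subseteq> V" "B \<subseteq> V" "finite A" "finite B"
proof -
  show "A \<inter> B = {}" using A_d B_d by fastforce
  show "A \<subseteq> V" "B \<subseteq> V" "finite A" "finite B" using ab by (auto simp: A_def B_def)
  have "x \<in> A \<union> B" if "x \<in> D" for x
  proof -
    have "d x a \<noteq> 0" "d x b \<noteq> 0" using d_eq_0[of x a] d_eq_0[of x b] ab that disj by auto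
    then have "d x a = 1 \<or> d x b = 1" using D_sum[OF that] by linarith
    then show ?thesis using that ab d_eq_1[of x a] d_eq_1[of x b] by (auto simp: A_def B_def)
  qed
  then show "A \<union> B = D" by (auto simp: A_def B_def)
qed

lemma B_nonempty: "B \<noteq> {}"
proof -
  have "\<exists>v\<in>D. adj v b" by (rule exit_both) (use nonempty D_closed ab disj in auto)
  then show ?thesis by (auto simp: B_def)
qed

lemma A_nonempty: "A \<noteq> {}"
  using short_cut.B_nonempty[OF swap] swap_defs by simp

lemma adj_AB: "adj x y \<Longrightarrow> x \<in> A \<Longrightarrow> y = a \<or> y \<in> B"
proof -
  assume xy: "adj x y" "x \<in> A"
  then have "y \<in> D \<union> {a, b}" using D_closed by (auto simp: A_def)
  moreover have "y \<noteq> b" using A_d[of x] adj_d[OF xy(1)] xy by auto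
  moreover have "y \<notin> A" using d_adj_neq[OF xy(1) ab(1)] A_d[of x] A_d[of y] xy by auto
  ultimately show ?thesis using AB by blast
qed

lemma E_diff:
  assumes "z \<in> E"
  shows "d z a < d z b \<or> d z b < d z a" "d z a \<le> d z b + 3" "d z b \<le> d z a + 3"
    "even (d z a + d z b + 1)"
proof -
  obtain u where u: "u \<in> A" using A_nonempty by blast
  \<comment> \<open>Bipartiteness in metric form: the three mutual distances of any
    \<open>p\<close>, \<open>q\<close>, \<open>z\<close> have even sum.\<close>
  have par: "even (d p z + d q z + d p q)" if "p \<in> V" "q \<in> V" for p q
    using that
  proof (induction "d p q" arbitrary: p)
    case 0
    then show ?case using d_eq_0[of p q] by simp
  next
    case (Suc n)
    then have "p \<noteq> q" using d_eq_0[of p q] by auto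
    then obtain w where w: "adj p w" "d p q = Suc (d w q)" using d_step Suc by blast
    have "z \<in> V" using assms ab by blast
    from w(1) this have "d p z = Suc (d w z) \<or> d w z = Suc (d p z)"
      by (rule adj_cases) auto
    moreover have "even (d w z + d q z + d w q)" using Suc w adj_V by simp
    ultimately show ?case using w by auto
  qed
  have zV: "z \<in> V" using assms ab by blast
  show ev: "even (d z a + d z b + 1)"
    using par[of a b] ab d_ab zV d_sym[of z a] d_sym[of z b] by simp
  then show "d z a < d z b \<or> d z b < d z a" by (metis even_add even_plus_one_iff linorder_neqE_nat)
  show "d z a \<le> d z b + 3" "d z b \<le> d z a + 3"
    using d_triangle[of z b a] d_triangle[of z a b] zV ab d_ab d_sym[of a b] by auto
qed

lemma E_split: "Ea \<union> Eb = E" "Ea \<inter> Eb = {}" "finite Ea" "finite Eb"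
  using E_diff ab by (auto simp: Ea_def Eb_def)

lemma disjoint: "A \<inter> E = {}" "B \<inter> E = {}" "Ea \<subseteq> E" "Eb \<subseteq> E" "a \<notin> A" "a \<notin> B" "b \<notin> A" "b \<notin> B"
    "a \<notin> Ea" "b \<notin> Ea" "a \<notin> Eb" "b \<notin> Eb" "A \<inter> Ea = {}" "B \<inter> Ea = {}" "A \<inter> Eb = {}" "B \<inter> Eb = {}"
  using disj by (auto simp: A_def B_def Ea_def Eb_def)

lemma d_sym_E: "z \<in> E \<Longrightarrow> d a z = d z a \<and> d b z = d z b"
  using d_sym ab by blast

text \<open>Otherwise \<open>Ea\<close> has no exits except \<open>a\<close> and \<open>b\<close>,
  and \<open>exit_both\<close> yields a neighbour of \<open>b\<close> that is still closer to
  \<open>a\<close>, hence equal to \<open>a\<close>.\<close>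

lemma crossing: "\<exists>x y. x \<in> Eb \<and> y \<in> Ea \<and> adj x y"
proof (rule ccontr)
  assume n: "\<not> ?thesis"
  have "\<exists>v\<in>E. adj v a" by (rule exit_both[of _ b]) (use nonempty E_closed ab disj in auto)
  then obtain v where v: "v \<in> E" "adj v a" by blast
  have vEa: "v \<in> Ea"
    using E_diff[OF v(1)] adj_d[OF v(2)] d_triangle[of a v b] v d_ab d_sym[of a v] ab
    by (auto simp: Ea_def)
  have "\<exists>v\<in>Ea. adj v b"
  proof (rule exit_both)
    fix x y assume "x \<in> Ea" "adj x y"
    then show "y \<in> Ea \<union> {a, b}"
      using n E_closed[of x y] E_split(1) adj_sym[of x y] disjoint(3) by blast
  qed (use vEa E_split ab disj in auto)
  then obtain w where w: "w \<in> Ea" "adj w b" by blast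
  then show False using adj_d[OF w(2)] d_eq_0[of w a] ab disj by (auto simp: Ea_def)
qed

lemma crossing_d:
  assumes "x \<in> Eb" "y \<in> Ea" "adj x y"
  shows "d x a = d x b + 1" "d y b = d y a + 1" "d x b = d y a"
proof -
  have "x \<in> V" "y \<in> V" using adj_V assms by blast+
  have "d x a = d x b + 1 \<and> d y b = d y a + 1 \<and> d x b = d y a"
    by (rule adj_cases[OF assms(3) ab(1)]; rule adj_cases[OF assms(3) ab(2)])
      (use assms(1,2) in \<open>auto simp: Ea_def Eb_def\<close>)
  then show "d x a = d x b + 1" "d y b = d y a + 1" "d x b = d y a" by auto
qed

text \<open>For \<open>z\<close> in \<open>E\<close> the vertex \<open>u\<close> beats
  \<open>a\<close> only on the route through \<open>b\<close>, of length \<open>2 + d z b\<close>.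
  Since \<open>d z a\<close> exceeds \<open>d z b\<close> by at most 3, this means a difference of
  exactly 3.\<close>

lemma closer_ua:
  assumes u: "u \<in> A"
  shows "{z \<in> V. d u z < d a z} = {u, b} \<union> {v \<in> B. adj u v} \<union> {z \<in> E. d z a = d z b + 3}"
    (is "?L = ?R")
proof -
  have uV: "u \<in> V" "u \<in> D" "adj u a" using u AB by (auto simp: A_def)
  note ud = A_d[OF u]
  have "z \<in> ?L \<longleftrightarrow> z \<in> ?R" if zV: "z \<in> V" for z
  proof -
    consider "z = a" | "z = b" | "z \<in> A" "z \<noteq> u" | "z = u" | "z \<in> B" | "z \<in> E"
      using zV V_eq AB by blast
    then show ?thesis
    proof cases
      case 1
      then show ?thesis using d_eq_0[of a a] ab uV disj by (auto simp: B_def)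
    next
      case 2
      then show ?thesis using ud d_ab ab by auto
    next
      case 3
      then have "d a z = 1" "d u z \<noteq> 0" using A_d d_sym[of a z] ab zV d_eq_0[of u z] uV by auto
      then show ?thesis using 3 AB disj by auto
    next
      case 4
      then show ?thesis using d_eq_0[of u u] uV ud d_sym[of a u] ab by auto
    next
      case 5
      then have "d a z = 2" using B_d d_sym[of a z] ab zV by auto
      moreover have "d u z \<noteq> 0" using d_eq_0[of u z] uV zV 5 u AB by auto
      ultimately have "d u z < d a z \<longleftrightarrow> d u z = 1" by linarith
      then show ?thesis using 5 zV uV d_eq_1[of u z] AB disj u by auto
    next
      case 6
      then have "d u z < d a z \<longleftrightarrow> d z a = d z b + 3"
        using d_D_E[OF uV(2) 6] ud d_sym_E[OF 6] E_diff[OF 6] by (auto simp: min_def)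
      then show ?thesis using 6 zV AB disj u by auto
    qed
  qed
  moreover have "?R \<subseteq> V" using uV ab AB by auto
  ultimately show ?thesis by blast
qed

lemma count_ua:
  assumes u: "u \<in> A"
  shows "card V = 2 * (2 + card {v \<in> B. adj u v} + card {z \<in> E. d z a = d z b + 3})"
proof -
  have "adj u a" using u by (simp add: A_def)
  then have "card V = 2 * card ({u, b} \<union> {v \<in> B. adj u v} \<union> {z \<in> E. d z a = d z b + 3})"
    using card_closer[of u a] closer_ua[OF u] by simp
  also have "card ({u, b} \<union> {v \<in> B. adj u v} \<union> {z \<in> E. d z a = d z b + 3}) =
      card ({u, b} \<union> {v \<in> B. adj u v}) + card {z \<in> E. d z a = d z b + 3}"
    using ab AB(6) disjoint disj u by (intro card_Un_disjoint) auto
  also have "card ({u, b} \<union> {v \<in> B. adj u v}) = card {u, b} + card {v \<in> B. adj u v}"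
    using AB(2,6) disjoint u by (intro card_Un_disjoint) auto
  also have "card {u, b} = 2" using disjoint u by (subst card_2_iff) blast
  finally show ?thesis by simp
qed

text \<open>By parity the distances of a vertex of \<open>E\<close> from \<open>a\<close> and
  \<open>b\<close> differ by 1 or 3. Edges between \<open>Ea\<close> and \<open>Eb\<close> can end
  only in vertices with difference 1.\<close>

definition "Ea1 = {z \<in> E. d z b = d z a + 1}"
definition "Eb1 = {z \<in> E. d z a = d z b + 1}"
definition "Eb3 = {z \<in> E. d z a = d z b + 3}"

lemma Eb_split: "Eb = Eb1 \<union> Eb3" "Eb1 \<inter> Eb3 = {}"
proof -
  have "z \<in> Eb1 \<or> z \<in> Eb3" if "z \<in> Eb" for z
  proof -
    have "z \<in> E" "d z b < d z a" using that by (auto simp: Eb_def)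
    moreover have "d z a \<noteq> d z b + 2" using E_diff(4)[OF \<open>z \<in> E\<close>] by auto
    ultimately show ?thesis using E_diff(2)[of z] by (auto simp: Eb1_def Eb3_def)
  qed
  then show "Eb = Eb1 \<union> Eb3" by (auto simp: Eb_def Eb1_def Eb3_def)
qed (auto simp: Eb1_def Eb3_def)

lemma swap_defs1: "short_cut.Eb1 d b a E = Ea1"
  by (simp add: Ea1_def short_cut.Eb1_def[OF swap])

lemma card_V: "card V = 2 + card A + card B + card Ea + card Eb"
proof -
  have "V = {a, b} \<union> (A \<union> B) \<union> (Ea \<union> Eb)" using V_eq AB E_split by simp
  moreover have "card ({a, b} \<union> (A \<union> B) \<union> (Ea \<union> Eb)) = card ({a, b} \<union> (A \<union> B)) + card (Ea \<union> Eb)"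
    using AB(5,6) E_split(3,4) disjoint by (intro card_Un_disjoint) auto
  moreover have "card ({a, b} \<union> (A \<union> B)) = card {a, b} + card (A \<union> B)"
    using AB(5,6) disjoint by (intro card_Un_disjoint) auto
  moreover have "card (A \<union> B) = card A + card B" "card (Ea \<union> Eb) = card Ea + card Eb"
    using AB(2,5,6) E_split(2,3,4) by (auto intro: card_Un_disjoint)
  moreover have "card {a, b} = 2" using ab by simp
  ultimately show ?thesis by (simp only: add.assoc)
qed

lemma card_Eb1: "card Eb = card Eb1 + card Eb3" "card Eb1 \<ge> 1"
proof -
  show "card Eb = card Eb1 + card Eb3"
    using Eb_split E_split by (metis card_Un_disjoint finite_Un)
  obtain x y where "x \<in> Eb" "y \<in> Ea" "adj x y" using crossing by blast
  then have "x \<in> Eb1" using crossing_d(1)[of x y] by (simp add: Eb_def Eb1_def)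
  then show "card Eb1 \<ge> 1" using E_split Eb_split
    by (metis One_nat_def Suc_leI card_gt_0_iff empty_iff finite_Un)
qed

text \<open>Adding the counts for the edges \<open>ua\<close> and \<open>vb\<close> and subtracting
  \<open>card_V\<close> shows that \<open>card Ea1 + card Eb1 + card A + card B\<close> equals 2
  plus the number of neighbours of \<open>u\<close> in \<open>B\<close> and of \<open>v\<close> in
  \<open>A\<close>. The first two terms are at least 1 by \<open>crossing\<close>, and the neighbour
  counts are at most \<open>card B\<close> and \<open>card A\<close>, so equality holds
  throughout.\<close>

lemma complete_AB:
  shows "card Eb1 = 1" "card Ea1 = 1" "u \<in> A \<Longrightarrow> v \<in> B \<Longrightarrow> adj u v"
    "card V = 2 * (2 + card B + card Eb3)"
proof -
  define Ea3 where "Ea3 = {z \<in> E. d z b = d z a + 3}"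
  have Ea3: "short_cut.Eb3 d b a E = Ea3" by (simp add: Ea3_def short_cut.Eb3_def[OF swap])
  have main: "card {v \<in> B. adj u v} = card B \<and> card Ea1 = 1 \<and> card Eb1 = 1"
    if uv: "u \<in> A" "v \<in> B" for u v
  proof -
    have "card V = 2 * (2 + card {w \<in> A. adj v w} + card Ea3)"
      using short_cut.count_ua[OF swap, of v] uv swap_defs by (simp add: Ea3_def)
    moreover have "card V = 2 * (2 + card {w \<in> B. adj u w} + card Eb3)"
      using count_ua[OF uv(1)] by (simp add: Eb3_def)
    moreover have *: "card {w \<in> A. adj v w} \<le> card A" "card {w \<in> B. adj u w} \<le> card B"
      "card Ea1 \<ge> 1" "card Eb1 \<ge> 1"
      using AB short_cut.card_Eb1[OF swap] swap_defs1 card_Eb1 by (auto intro: card_mono)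
    moreover have "card Ea = card Ea1 + card Ea3"
      using short_cut.card_Eb1[OF swap] swap_defs swap_defs1 Ea3 by simp_all
    moreover note card_V card_Eb1
    ultimately have "card Ea1 + card Eb1 + (card A + card B) =
        2 + (card {w \<in> A. adj v w} + card {w \<in> B. adj u w})" by simp
    then have "card {v \<in> B. adj u v} = card B" "card Ea1 = 1" "card Eb1 = 1"
      using * by linarith+
    then show ?thesis by blast
  qed
  obtain u0 v0 where uv0: "u0 \<in> A" "v0 \<in> B" using A_nonempty B_nonempty by blast
  show "card Eb1 = 1" "card Ea1 = 1" using main uv0 by blast+
  show "card V = 2 * (2 + card B + card Eb3)"
    using count_ua[OF uv0(1)] main[OF uv0] by (simp add: Eb3_def)
  assume uv: "u \<in> A" "v \<in> B"
  have "{v \<in> B. adj u v} = B"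
    using main[OF uv] AB by (intro card_subset_eq) auto
  then show "adj u v" using uv by blast
qed

text \<open>For \<open>u\<close> in \<open>A\<close> and \<open>v\<close> in \<open>B\<close> the
  set \<open>W\<^sub>u\<^sub>v\<close> consists of \<open>u\<close>, \<open>a\<close>,
  \<open>B - {v}\<close> and \<open>Ea\<close>. Comparing its size with
  \<open>complete_AB(4)\<close>, where \<open>card Eb3 = card Eb - 1\<close>, gives
  \<open>card Ea = card Eb\<close>, and then \<open>card_V\<close> gives the rest.\<close>

lemma card_equal: "card A = card B" "card Ea = card Eb"
proof -
  obtain u v where uv: "u \<in> A" "v \<in> B" using A_nonempty B_nonempty by blast
  have V: "u \<in> V" "v \<in> V" "u \<in> D" "v \<in> D" using uv AB by auto
  have e: "adj u v" using complete_AB uv by blast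
  have "{z \<in> V. d u z < d v z} = ({u, a} \<union> (B - {v})) \<union> Ea" (is "?L = ?R")
  proof -
    have "z \<in> ?L \<longleftrightarrow> z \<in> ?R" if zV: "z \<in> V" for z
    proof -
      consider "z = a" | "z = b" | "z \<in> A" "z \<noteq> u" | "z = u" | "z \<in> B" "z \<noteq> v" | "z = v" | "z \<in> E"
        using zV V_eq AB by blast
      then show ?thesis
      proof cases
        case 1 then show ?thesis using A_d[OF uv(1)] B_d[OF uv(2)] ab by auto
      next
        case 2
        then show ?thesis using A_d[OF uv(1)] B_d[OF uv(2)] ab uv AB disj E_split by auto
      next
        case 3
        then have "d v z = 1" "d u z \<noteq> 0"
          using complete_AB(3)[of z v] adj_d adj_sym uv d_eq_0[of u z] V zV by blast+
        then show ?thesis using 3 uv AB disj E_split by auto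
      next
        case 4
        then show ?thesis using d_eq_0[of u u] d_eq_0[of v u] V uv AB by auto
      next
        case 5
        then have "d u z = 1" "d v z \<noteq> 0"
          using complete_AB(3)[of u z] adj_d adj_sym uv d_eq_0[of v z] V zV by blast+
        moreover have "d v z \<noteq> 1" using d_adj_neq[OF e zV] \<open>d u z = 1\<close> by simp
        ultimately show ?thesis using 5 V zV by auto
      next
        case 6
        then show ?thesis using d_eq_0[of v v] V uv AB E_split disj by auto
      next
        case 7
        then have "d u z < d v z \<longleftrightarrow> z \<in> Ea"
          using d_D_E[OF V(3) 7] d_D_E[OF V(4) 7] A_d[OF uv(1)] B_d[OF uv(2)] d_sym_E[OF 7]
          by (auto simp: min_def Ea_def)
        then show ?thesis using 7 zV AB disj uv by auto
      qed
    qed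
    moreover have "?R \<subseteq> V" using V ab AB E_split by auto
    ultimately show ?thesis by blast
  qed
  moreover have "card (({u, a} \<union> (B - {v})) \<union> Ea) = card ({u, a} \<union> (B - {v})) + card Ea"
    using AB(6) E_split(3) disjoint uv by (intro card_Un_disjoint) auto
  moreover have "card ({u, a} \<union> (B - {v})) = card {u, a} + card (B - {v})"
    using AB(2,6) disjoint uv by (intro card_Un_disjoint) auto
  moreover have "card {u, a} = 2" using disjoint uv by (subst card_2_iff) blast
  moreover have "card B = Suc (card (B - {v}))" using card_Suc_Diff1[OF AB(6) uv(2)] by simp
  ultimately have "card V = 2 * (1 + card B + card Ea)" using card_closer[OF e] by simp
  moreover have "card V = 2 * (1 + card B + card Eb)"
    using card_Eb1(1) complete_AB(1,4) by simp
  ultimately show "card A = card B" "card Ea = card Eb" using card_V by simp_all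
qed

end

section \<open>Unions of geodesics, their levels and their excess\<close>

text \<open>Every vertex of \<open>Q\<close> lies on a geodesic of length \<open>k\<close> from
  \<open>b\<close> to \<open>x\<close>, and \<open>down\<close> and \<open>up\<close> keep such
  geodesics inside \<open>Q\<close>. The distances are those of the whole graph. The locale serves
  for both segments and for each of them read from its other end.\<close>

locale segment = balanced_metric +
  fixes Q :: "'a set" and b x :: 'a and k :: nat
  assumes Q_V: "Q \<subseteq> V"
    and ends: "b \<in> Q" "x \<in> Q"
    and level_sum: "z \<in> Q \<Longrightarrow> d z b + d z x = k"
    and down: "z \<in> Q \<Longrightarrow> z \<noteq> b \<Longrightarrow> \<exists>w\<in>Q. adj z w \<and> d z b = Suc (d w b)"
    and up: "z \<in> Q \<Longrightarrow> z \<noteq> x \<Longrightarrow> \<exists>w\<in>Q. adj z w \<and> d z x = Suc (d w x)"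
begin

lemma reverse: "segment V adj d Q x b k"
  using Q_V ends level_sum down up by unfold_locales (auto simp: add.commute)

lemma finite_Q: "finite Q"
  using Q_V finite_V finite_subset by blast

lemma Q_in_V: "z \<in> Q \<Longrightarrow> z \<in> V"
  using Q_V by blast

lemma level_le: "z \<in> Q \<Longrightarrow> d z b \<le> k"
  using level_sum[of z] by linarith

definition level :: "nat \<Rightarrow> 'a set" where
  "level i = {z \<in> Q. d z b = i}"

lemma level_0: "level 0 = {b}"
  using ends d_eq_0 Q_in_V by (auto simp: level_def)

lemma finite_level: "finite (level i)"
  using finite_Q by (simp add: level_def)

lemma level_reverse:
  assumes "i \<le> k"
  shows "segment.level d Q x i = level (k - i)"
proof -
  have "d z x = i \<longleftrightarrow> d z b = k - i" if "z \<in> Q" for z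
    using level_sum[OF that] assms by linarith
  then show ?thesis by (auto simp: level_def segment.level_def[OF reverse])
qed

lemma level_k: "level k = {x}"
  using segment.level_0[OF reverse] level_reverse[of 0] by simp

lemma descend:
  assumes "z \<in> Q" "i \<le> d z b"
  shows "\<exists>w\<in>level i. d z w + i = d z b"
  using assms
proof (induction "d z b - i" arbitrary: z)
  case 0
  then show ?case using d_eq_0[of z z] Q_in_V by (intro bexI[of _ z]) (auto simp: level_def)
next
  case (Suc n)
  then have "z \<noteq> b" using d_eq_0[of b b] ends Q_in_V by auto
  then obtain w where w: "w \<in> Q" "adj z w" "d z b = Suc (d w b)" using down Suc by blast
  have "n = d w b - i" "i \<le> d w b" using w(3) Suc.hyps(2) by linarith+
  then obtain p where p: "p \<in> level i" "d w p + i = d w b"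
    using Suc.hyps(1)[of w] w(1) by blast
  have V: "z \<in> V" "p \<in> V" "w \<in> V" "b \<in> V" "d p b = i"
    using p Suc w Q_in_V ends by (auto simp: level_def)
  have "d z p \<le> 1 + d w p" using d_triangle[of z w p] V adj_d[OF w(2)] by simp
  moreover have "d z b \<le> d z p + i" using d_triangle[of z p b] V by simp
  ultimately show ?case using p w by (intro bexI[of _ p]) auto
qed

lemma ascend:
  assumes "z \<in> Q" "d z b \<le> i" "i \<le> k"
  shows "\<exists>w\<in>level i. d z w + d z b = i"
proof -
  have "\<exists>w\<in>level i. d z w + (k - i) = d z x"
    using segment.descend[OF reverse assms(1), of "k - i"] level_reverse[of "k - i"] assms
      level_sum[OF assms(1)] by simp
  then obtain w where "w \<in> level i" "d z w + (k - i) = d z x" by blast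
  moreover from this have "d z w + d z b = i" using level_sum[OF assms(1)] assms by linarith
  ultimately show ?thesis by blast
qed

lemma level_nonempty: "i \<le> k \<Longrightarrow> level i \<noteq> {}"
  using ascend[of b i] ends d_eq_0[of b b] Q_in_V by auto

lemma card_level_pos: "i \<le> k \<Longrightarrow> 1 \<le> card (level i)"
  using level_nonempty finite_level by (simp add: Suc_le_eq card_gt_0_iff)

lemma adj_in_level:
  assumes "z \<in> Q" "w \<in> Q" "adj z w"
  shows "d z b = Suc (d w b) \<or> d w b = Suc (d z b)"
  using assms ends Q_in_V by (blast intro: adj_cases[of z w b])

text \<open>This is the distance that would result if consecutive levels were completely joined. In
  any segment it is a lower bound for \<open>d\<close>; the value 2 inside a level comes from
  bipartiteness.\<close>

definition gap :: "'a \<Rightarrow> 'a \<Rightarrow> int" where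
  "gap z y = (if z = y then 0 else if d z b = d y b then 2 else \<bar>int (d z b) - int (d y b)\<bar>)"

text \<open>The total amount by which distances from \<open>z\<close> inside the segment exceed the lower bound
  dictated by the levels.\<close>

definition excess :: "'a \<Rightarrow> int" where
  "excess z = (\<Sum>y\<in>Q. int (d z y) - gap z y)"

lemma gap_reverse: "z \<in> Q \<Longrightarrow> y \<in> Q \<Longrightarrow> segment.gap d x z y = gap z y"
proof -
  assume zy: "z \<in> Q" "y \<in> Q"
  have "int (d z x) = int k - int (d z b)" "int (d y x) = int k - int (d y b)"
    using level_sum[OF zy(1)] level_sum[OF zy(2)] by linarith+
  then show ?thesis by (auto simp: gap_def segment.gap_def[OF reverse])
qed

lemma excess_reverse: "z \<in> Q \<Longrightarrow> segment.excess d Q x z = excess z"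
  by (simp add: excess_def segment.excess_def[OF reverse] gap_reverse)

lemma gap_le:
  assumes zy: "z \<in> Q" "y \<in> Q"
  shows "gap z y \<le> int (d z y)"
proof -
  have V: "z \<in> V" "y \<in> V" "b \<in> V" using zy Q_in_V ends by auto
  have "d z b \<le> d z y + d y b" "d y b \<le> d z y + d z b"
    using d_triangle[of z y b] d_triangle[of y z b] V d_sym[of y z] by auto
  moreover have "2 \<le> d z y" if "z \<noteq> y" "d z b = d y b"
  proof -
    have "d z y \<noteq> 0" using that V d_eq_0 by blast
    moreover have "d z y \<noteq> 1" using that V d_eq_1 d_adj_neq by blast
    ultimately show ?thesis by linarith
  qed
  ultimately show ?thesis by (auto simp: gap_def)
qed

lemma excess_nonneg: "z \<in> Q \<Longrightarrow> 0 \<le> excess z"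
  unfolding excess_def using gap_le by (intro sum_nonneg) simp

lemma excess_0_d:
  assumes "z \<in> Q" "excess z = 0" "y \<in> Q"
  shows "int (d z y) = gap z y"
proof -
  have "\<forall>y\<in>Q. int (d z y) - gap z y = 0"
    using assms(2) gap_le[OF assms(1)] finite_Q
    unfolding excess_def by (subst (asm) sum_nonneg_eq_0_iff) auto
  then show ?thesis using assms(3) by auto
qed

text \<open>Passing from \<open>z\<close> up to \<open>w\<close> changes every distance by 1 in one
  direction or the other, and likewise every gap. The gap to \<open>p\<close> falls if
  \<open>p\<close> is in the level of \<open>z\<close> or at least two levels higher, and rises
  otherwise; the exceptions \<open>p = z\<close> and \<open>p = w\<close> cancel in the sum.\<close>

lemma excess_diff:
  assumes zw: "z \<in> Q" "w \<in> Q" "adj z w" "d w b = Suc (d z b)"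
  shows "excess z - excess w = 2 * int (card {p \<in> Q. d w p < d z p})
    - 2 * int (card (level (d z b))) - 2 * int (card {p \<in> Q. d z b + 2 \<le> d p b})"
proof -
  have "z \<noteq> w" using zw by auto
  define P where "P p \<longleftrightarrow> d z b + 2 \<le> d p b" for p
  have pointwise: "(int (d z p) - gap z p) - (int (d w p) - gap w p) =
      2 * of_bool (d w p < d z p) - 2 * of_bool (d p b = d z b) - 2 * of_bool (P p)
      + 2 * of_bool (p = z) - 2 * of_bool (p = w)" if p: "p \<in> Q" for p
  proof -
    have 1: "int (d z p) - int (d w p) = 2 * of_bool (d w p < d z p) - 1"
      by (rule adj_cases[OF zw(3), of p]) (use p Q_in_V in auto)
    have 2: "gap z p - gap w p =
        2 * of_bool (d p b = d z b) + 2 * of_bool (P p) - 1 - 2 * of_bool (p = z) + 2 * of_bool (p = w)"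
      using \<open>z \<noteq> w\<close> zw(4) by (auto simp: gap_def P_def)
    show ?thesis using 1 2 by simp
  qed
  have cnt: "(\<Sum>p\<in>Q. of_bool (S p)) = int (card {p \<in> Q. S p})" for S
    using finite_Q by (simp add: Int_def)
  have one: "{p \<in> Q. p = z} = {z}" "{p \<in> Q. p = w} = {w}" using zw by auto
  have "excess z - excess w = (\<Sum>p\<in>Q. 2 * of_bool (d w p < d z p) - 2 * of_bool (d p b = d z b)
      - 2 * of_bool (P p) + 2 * of_bool (p = z) - 2 * of_bool (p = w))"
    unfolding excess_def sum_subtractf[symmetric] by (rule sum.cong[OF refl pointwise])
  also have "\<dots> = 2 * int (card {p \<in> Q. d w p < d z p}) - 2 * int (card {p \<in> Q. d p b = d z b})
      - 2 * int (card {p \<in> Q. P p})"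
    by (simp only: sum_subtractf sum.distrib sum_distrib_left[symmetric] cnt one) simp
  finally show ?thesis by (simp add: level_def P_def)
qed

text \<open>From any vertex some geodesic towards \<open>b\<close> or towards \<open>x\<close> meets
  the level of \<open>z\<close>, hence passes through \<open>z\<close> itself, and so the level
  difference is attained.\<close>

lemma excess_single:
  assumes z: "z \<in> Q" "level (d z b) = {z}"
  shows "excess z = 0"
  unfolding excess_def
proof (rule sum.neutral, rule ballI)
  fix y assume y: "y \<in> Q"
  have "int (d z y) \<le> gap z y"
  proof (cases "d z b \<le> d y b")
    case True
    then have "d y z + d z b = d y b" using descend[OF y True] z(2) by auto
    then have "d z y + d z b = d y b" using d_sym z(1) y Q_in_V by simp
    moreover have "y = z" if "d y b = d z b" using that y z(2) by (auto simp: level_def)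
    ultimately show ?thesis by (auto simp: gap_def)
  next
    case False
    then have "d y z + d y b = d z b" using ascend[OF y, of "d z b"] z level_le[OF z(1)] by auto
    then have "d z y + d y b = d z b" using d_sym z(1) y Q_in_V by simp
    then show ?thesis using False by (auto simp: gap_def)
  qed
  then show "int (d z y) - gap z y = 0" using gap_le[OF z(1) y] by simp
qed

lemma excess_single_level:
  assumes const: "\<And>z. z \<in> Q \<Longrightarrow> excess z = X (d z b)"
    and card: "card (level i) = 1"
  shows "X i = 0"
proof -
  obtain z where "level i = {z}" using card by (auto simp: card_1_singleton_iff)
  moreover from this have "z \<in> Q" "d z b = i" by (auto simp: level_def)
  ultimately show ?thesis using excess_single[of z] const[of z] by simp
qed

lemma complete_below:
  assumes "z \<in> Q" "y \<in> Q" "d z b = Suc i" "d y b = i" "excess y = 0"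
  shows "adj z y"
proof -
  have "int (d y z) = gap y z" using excess_0_d assms by blast
  also have "gap y z = 1" using assms by (auto simp: gap_def)
  finally have "adj y z" using d_eq_1[of y z] assms Q_in_V by simp
  then show ?thesis by (rule adj_sym)
qed

text \<open>A vertex of level \<open>Suc i\<close> has no excess towards levels up to its own, at
  most 2 towards each vertex of the next level other than a chosen neighbour \<open>t\<close> there,
  and towards higher levels no more than \<open>t\<close> has. Inserted into \<open>count\<close>,
  this leaves no room for excess of \<open>t\<close> towards level \<open>Suc i\<close>, so the two
  levels are completely joined. Then the excess cannot decrease from level \<open>Suc i\<close> to
  the next, and \<open>count\<close> permits only one vertex there.\<close>

lemma level_collapse:
  assumes const: "\<And>z. z \<in> Q \<Longrightarrow> excess z = X (d z b)"
    and i: "Suc (Suc i) \<le> k"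
    and X_i: "X i = 0"
    and count: "2 * int (card (level (Suc (Suc i)))) + X (Suc (Suc i)) = 2 + X (Suc i)"
  shows "card (level (Suc (Suc i))) = 1" "X (Suc i) = 0" "X (Suc (Suc i)) = 0"
proof -
  let ?j = "Suc i"
  define e where "e z y = int (d z y) - gap z y" for z y
  have e_ge: "0 \<le> e z y" if "z \<in> Q" "y \<in> Q" for z y
    using gap_le[OF that] by (simp add: e_def)
  define L where "L = level (Suc ?j)"
  define H where "H = {y \<in> Q. Suc ?j < d y b}"
  define S where "S = {y \<in> Q. d y b \<le> ?j}"
  have sets: "Q = S \<union> (L \<union> H)" "S \<inter> (L \<union> H) = {}" "L \<inter> H = {}"
    "finite S" "finite L" "finite H" "L \<subseteq> Q" "H \<subseteq> Q" "S \<subseteq> Q"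
    using finite_Q by (auto simp: S_def L_def H_def level_def)
  have split: "excess z = sum (e z) S + sum (e z) L + sum (e z) H" for z
  proof -
    have "excess z = sum (e z) (S \<union> (L \<union> H))" unfolding excess_def e_def using sets(1) by simp
    then show ?thesis using sets by (simp add: sum.union_disjoint)
  qed
  \<comment> \<open>Because \<open>X i = 0\<close>, distances from a lower neighbour
    \<open>p\<close> of \<open>z\<close> are exact, and the step from \<open>z\<close> to
    \<open>p\<close> costs 1. Only a level-\<open>i\<close> target needs the complete join from
    \<open>complete_below\<close>.\<close>
  have low: "e z y = 0" if z: "z \<in> Q" "d z b = ?j" and y: "y \<in> S" for z y
  proof -
    have yQ: "y \<in> Q" "d y b \<le> ?j" using y by (auto simp: S_def)
    have "z \<noteq> b" using z d_eq_0[of b b] ends Q_in_V by auto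
    then obtain p where p: "p \<in> Q" "adj z p" "d z b = Suc (d p b)" using down z by blast
    have ep: "excess p = 0" using const p z X_i by simp
    have V: "z \<in> V" "y \<in> V" "p \<in> V" using z yQ p Q_in_V by auto
    have le: "d z y \<le> 1 + d p y" using d_triangle[of z p y] V adj_d[OF p(2)] by simp
    have dp: "int (d p y) = gap p y" using excess_0_d p ep yQ by blast
    consider "y = z" | "d y b = ?j" "y \<noteq> z" | "d y b = i" | "d y b < i" using yQ by linarith
    then have "int (d z y) \<le> gap z y"
    proof cases
      case 1 then show ?thesis using d_eq_0 V by (simp add: gap_def)
    next
      case 2
      then have "gap p y = 1" "gap z y = 2" using p z by (auto simp: gap_def)
      then show ?thesis using dp le by simp
    next
      case 3
      then have "adj z y" using complete_below[of z y i] z yQ const X_i by simp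
      then show ?thesis using adj_d 3 z by (auto simp: gap_def)
    next
      case 4
      then have "gap p y = int i - int (d y b)" "gap z y = int ?j - int (d y b)"
        using p z by (auto simp: gap_def)
      then show ?thesis using dp le by simp
    qed
    then show ?thesis using gap_le[OF z(1) yQ(1)] by (simp add: e_def)
  qed
  \<comment> \<open>A lower neighbour of \<open>y\<close> is in the level of \<open>z\<close>, at
    distance at most 2 by \<open>low\<close>; so \<open>d z y\<close> is at most 3, while the gap is
    1.\<close>
  have mid: "e z y \<le> 2" if z: "z \<in> Q" "d z b = ?j" and y: "y \<in> L" for z y
  proof -
    have yQ: "y \<in> Q" "d y b = Suc ?j" using y by (auto simp: L_def level_def)
    have "y \<noteq> b" using yQ d_eq_0[of b b] ends Q_in_V by auto
    then obtain p where p: "p \<in> Q" "adj y p" "d y b = Suc (d p b)" using down yQ by blast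
    then have "e z p = 0" using low[OF z] yQ by (simp add: S_def)
    then have "d z p \<le> 2" using p z yQ by (auto simp: e_def gap_def split: if_splits)
    moreover have "d z y \<le> d z p + d p y" using d_triangle z yQ p Q_in_V by blast
    moreover have "d p y = 1" using adj_d adj_sym p by blast
    ultimately show ?thesis using z yQ by (auto simp: e_def gap_def)
  qed
  \<comment> \<open>For a target above both, the gap from \<open>t\<close> is smaller by 1, and the
    distance from \<open>t\<close> is smaller by at most 1.\<close>
  have high: "sum (e z) H \<le> sum (e t) H" if z: "z \<in> Q" "d z b = ?j" and t: "t \<in> L" "adj z t" for z t
  proof (rule sum_mono)
    fix y assume "y \<in> H"
    then have y: "y \<in> Q" "Suc ?j < d y b" by (auto simp: H_def)
    have tQ: "t \<in> Q" "d t b = Suc ?j" using t by (auto simp: L_def level_def)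
    have "d z y \<le> 1 + d t y"
      using d_triangle[of z t y] adj_d[OF t(2)] z y tQ Q_in_V by simp
    then show "e z y \<le> e t y" using z tQ y by (auto simp: e_def gap_def)
  qed
  have adj_lvl: "\<exists>z\<in>Q. d z b = ?j \<and> adj z t" if "t \<in> L" for t
  proof -
    have tQ: "t \<in> Q" "d t b = Suc ?j" using that by (auto simp: L_def level_def)
    then have "t \<noteq> b" using d_eq_0[of b b] ends Q_in_V by auto
    then show ?thesis using down[OF tQ(1)] tQ adj_sym by auto
  qed
  have complete: "adj z t" if t: "t \<in> L" and z: "z \<in> Q" "d z b = ?j" for z t
  proof -
    obtain z' where z': "z' \<in> Q" "d z' b = ?j" "adj z' t" using adj_lvl[OF t] by blast
    have tQ: "t \<in> Q" "d t b = Suc ?j" using t by (auto simp: L_def level_def)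
    have "e z' t = 0" using adj_d[OF z'(3)] z' tQ by (auto simp: e_def gap_def)
    then have "sum (e z') L = sum (e z') (L - {t})" using t sets by (simp add: sum.remove[of L t])
    also have "\<dots> \<le> (\<Sum>y\<in>L - {t}. 2)" using mid z' by (intro sum_mono) auto
    also have "\<dots> = 2 * int (card L) - 2"
      using card_Suc_Diff1[OF sets(5) t] by simp
    finally have 1: "sum (e z') L \<le> 2 * int (card L) - 2" .
    have "sum (e z') S = 0" using low z' by (intro sum.neutral) blast
    then have 2: "X ?j \<le> 2 * int (card L) - 2 + sum (e t) H"
      using split[of z'] const[OF z'(1)] z' 1 high[OF z'(1,2) t z'(3)] by simp
    have zS: "z \<in> S" using z by (simp add: S_def)
    have "0 \<le> sum (e t) L" using e_ge tQ sets by (intro sum_nonneg) auto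
    moreover have "e t z \<le> sum (e t) S" using e_ge tQ sets zS by (intro member_le_sum) auto
    moreover have "X (Suc ?j) = sum (e t) S + sum (e t) L + sum (e t) H"
      using split[of t] const[OF tQ(1)] tQ by simp
    ultimately have "e t z \<le> 0" using 2 count by (simp add: L_def)
    then have "d t z \<le> 1" using tQ z by (auto simp: e_def gap_def split: if_splits)
    moreover have "d t z \<noteq> 0" using d_eq_0[of t z] tQ z Q_in_V by auto
    ultimately have "adj t z" using d_eq_1[of t z] tQ z Q_in_V by simp
    then show ?thesis by (rule adj_sym)
  qed
  obtain t where t: "t \<in> L" using level_nonempty[OF i] by (auto simp: L_def)
  have tQ: "t \<in> Q" "d t b = Suc ?j" using t by (auto simp: L_def level_def)
  obtain z where z: "z \<in> Q" "d z b = ?j" "adj z t" using adj_lvl[OF t] by blast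
  have "sum (e z) S = 0" using low z by (intro sum.neutral) blast
  moreover have "sum (e z) L = 0"
  proof (intro sum.neutral ballI)
    fix y assume y: "y \<in> L"
    then have "d z y = 1" using complete[OF y z(1,2)] adj_d by blast
    then show "e z y = 0" using y z by (auto simp: e_def gap_def L_def level_def)
  qed
  ultimately have "X ?j \<le> sum (e t) H"
    using split[of z] const[OF z(1)] z high[OF z(1,2) t z(3)] by simp
  moreover have "0 \<le> sum (e t) L" "0 \<le> sum (e t) S"
    using e_ge tQ sets by (auto intro!: sum_nonneg)
  ultimately have "X ?j \<le> X (Suc ?j)" using split[of t] const[OF tQ(1)] tQ by simp
  then have "card L \<le> 1" using count by (simp add: L_def)
  then show 1: "card (level (Suc (Suc i))) = 1"
    using card_level_pos[OF i] by (simp add: L_def)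
  show "X (Suc (Suc i)) = 0" using excess_single_level[OF const 1] by simp
  then show "X (Suc i) = 0" using count 1 by simp
qed

end

section \<open>The recursion for level sizes and excesses\<close>

text \<open>The two sequences of level sizes and excesses of opposite segments determine each other by
  second differences; the collapse hypotheses exclude positive excess.\<close>

locale level_recursion =
  fixes k m :: nat and q s :: "nat \<Rightarrow> nat" and X Y :: "nat \<Rightarrow> int"
  assumes k_pos: "1 \<le> k"
    and pos: "i \<le> k \<Longrightarrow> 1 \<le> q i" "i \<le> k \<Longrightarrow> 1 \<le> s i"
    and nonneg: "i \<le> k \<Longrightarrow> 0 \<le> X i" "i \<le> k \<Longrightarrow> 0 \<le> Y i"
    and start: "q 0 = 1" "q 1 = 1" "s 0 = 1" "s 1 = m" "X 0 = 0" "X 1 = 0" "Y 0 = 0" "Y 1 = 0"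
    and finish: "X k = 0" "X (k - 1) = 0" "Y k = 0"
    and rec_q: "i + 2 \<le> k \<Longrightarrow>
      2 * int (q i) - 2 * int (q (i + 1)) + 2 * int (q (i + 2)) + X i - 2 * X (i + 1) + X (i + 2)
        = 2 * int (s (i + 2))"
    and rec_s: "i + 2 \<le> k \<Longrightarrow>
      2 * int (s i) - 2 * int (s (i + 1)) + 2 * int (s (i + 2)) + Y i - 2 * Y (i + 1) + Y (i + 2)
        = 2 * int (q i)"
    and collapse_q: "i + 2 \<le> k \<Longrightarrow> X i = 0 \<Longrightarrow> 2 * int (q (i + 2)) + X (i + 2) = 2 + X (i + 1) \<Longrightarrow>
      q (i + 2) = 1 \<and> X (i + 1) = 0 \<and> X (i + 2) = 0"
    and collapse_s: "i + 2 \<le> k \<Longrightarrow> Y i = 0 \<Longrightarrow> 2 * int (s (i + 2)) + Y (i + 2) = 2 + Y (i + 1) \<Longrightarrow>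
      s (i + 2) = 1 \<and> Y (i + 1) = 0 \<and> Y (i + 2) = 0"
begin

text \<open>A period starts at \<open>i\<close> with sizes \<open>(1, 1)\<close> and
  \<open>(1, m)\<close>. First \<open>2 * s (i + 2) + Y (i + 2) = 2 * m\<close>, and then the next
  instance of \<open>rec_s\<close> is exactly the premise of \<open>collapse_s\<close>. The excess
  \<open>X (i + 2)\<close> is removed by looking two levels ahead, where
  \<open>s (i + 4) \<ge> 1\<close> forces \<open>q (i + 2) \<ge> m\<close>.\<close>

lemma block_2:
  assumes i: "i + 2 \<le> k"
    and 0: "q i = 1" "s i = 1" "X i = 0" "Y i = 0"
    and 1: "q (i + 1) = 1" "s (i + 1) = m" "X (i + 1) = 0" "Y (i + 1) = 0"
  shows "q (i + 2) = m" "s (i + 2) = m" "X (i + 2) = 0" "Y (i + 2) = 0"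
    "i + 3 \<le> k \<Longrightarrow> s (i + 3) = 1 \<and> Y (i + 3) = 0"
proof -
  have q2: "2 * int (q (i + 2)) + X (i + 2) = 2 * int (s (i + 2))"
    using rec_q[OF i] 0 1 by simp
  have s2: "2 * int (s (i + 2)) + Y (i + 2) = 2 * int m"
    using rec_s[OF i] 0 1 by simp
  have s3: "s (i + 3) = 1 \<and> Y (i + 2) = 0 \<and> Y (i + 3) = 0" if "i + 3 \<le> k"
  proof -
    have "2 * int (s (i + 3)) + Y (i + 3) = 2 + Y (i + 2)"
      using rec_s[of "i + 1"] that 1 s2 by (simp add: numeral_3_eq_3)
    then show ?thesis using collapse_s[of "i + 1"] that 1 by (simp add: numeral_3_eq_3)
  qed
  then show "i + 3 \<le> k \<Longrightarrow> s (i + 3) = 1 \<and> Y (i + 3) = 0" by blast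
  show Y: "Y (i + 2) = 0" using s3 finish i by (cases "i + 2 = k") auto
  then show s: "s (i + 2) = m" using s2 by simp
  \<comment> \<open>In the first two cases the segment ends before level \<open>i + 4\<close>, and
    the boundary values in \<open>finish\<close> replace the missing equation.\<close>
  consider "k = i + 2" | "k = i + 3" | "i + 4 \<le> k" using i by linarith
  then show X: "X (i + 2) = 0"
  proof cases
    case 1 then show ?thesis using finish by simp
  next
    case 2 then show ?thesis using finish by simp
  next
    case 3
    then have "2 * int (s (i + 4)) + Y (i + 4) = 2 * int (q (i + 2)) + 2 - 2 * int m"
      using rec_s[of "i + 2"] s3 s Y by (simp add: eval_nat_numeral)
    moreover have "1 \<le> s (i + 4)" "0 \<le> Y (i + 4)" "0 \<le> X (i + 2)" using pos nonneg 3 by auto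
    ultimately show ?thesis using q2 s by simp
  qed
  show "q (i + 2) = m" using q2 X s by simp
qed

text \<open>The equation for \<open>s (i + 4)\<close> leaves only the value 1. With it
  \<open>rec_q\<close> at \<open>i + 2\<close> becomes the premise of \<open>collapse_q\<close>,
  which also removes the excess \<open>X (i + 3)\<close>.\<close>

lemma block_3:
  assumes i: "i + 3 \<le> k"
    and 0: "q i = 1" "s i = 1" "X i = 0" "Y i = 0"
    and 1: "q (i + 1) = 1" "s (i + 1) = m" "X (i + 1) = 0" "Y (i + 1) = 0"
  shows "q (i + 3) = m" "s (i + 3) = 1" "X (i + 3) = 0" "Y (i + 3) = 0"
    "i + 4 \<le> k \<Longrightarrow> q (i + 4) = 1 \<and> s (i + 4) = 1 \<and> X (i + 4) = 0 \<and> Y (i + 4) = 0"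
proof -
  have "i + 2 \<le> k" using i by simp
  note b2 = block_2[OF this 0 1]
  show s3: "s (i + 3) = 1" "Y (i + 3) = 0" using b2(5) i by auto
  have q3: "2 * int (q (i + 3)) + X (i + 3) = 2 * int m"
    using rec_q[of "i + 1"] i b2 s3 1 by (simp add: eval_nat_numeral)
  have 4: "X (i + 3) = 0 \<and> q (i + 4) = 1 \<and> s (i + 4) = 1 \<and> X (i + 4) = 0 \<and> Y (i + 4) = 0"
    if "i + 4 \<le> k"
  proof -
    have "2 * int (s (i + 4)) + Y (i + 4) = 2"
      using rec_s[of "i + 2"] that b2 s3 by (simp add: eval_nat_numeral)
    moreover have "1 \<le> s (i + 4)" "0 \<le> Y (i + 4)" using pos nonneg that by auto
    ultimately have s4: "s (i + 4) = 1" "Y (i + 4) = 0" by auto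
    have "2 * int (q (i + 4)) + X (i + 4) = 2 + X (i + 3)"
      using rec_q[of "i + 2"] that b2 s4 q3 by (simp add: eval_nat_numeral)
    then show ?thesis using collapse_q[of "i + 2"] that b2 s4 by (simp add: eval_nat_numeral)
  qed
  then show "i + 4 \<le> k \<Longrightarrow> q (i + 4) = 1 \<and> s (i + 4) = 1 \<and> X (i + 4) = 0 \<and> Y (i + 4) = 0" by blast
  show "X (i + 3) = 0" using 4 finish i by (cases "i + 3 = k") auto
  then show "q (i + 3) = m" using q3 by simp
qed

text \<open>The two recursions combine to \<open>2 * q (i + 5) + X (i + 5) + Y (i + 5) = 2\<close>.
  Positivity of \<open>q\<close> and nonnegativity of the excesses decide everything, and a new
  period begins at \<open>i + 4\<close>.\<close>

lemma block_5:
  assumes i: "i + 5 \<le> k"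
    and 0: "q i = 1" "s i = 1" "X i = 0" "Y i = 0"
    and 1: "q (i + 1) = 1" "s (i + 1) = m" "X (i + 1) = 0" "Y (i + 1) = 0"
  shows "q (i + 5) = 1" "s (i + 5) = m" "X (i + 5) = 0" "Y (i + 5) = 0"
proof -
  have "i + 3 \<le> k" "i + 4 \<le> k" using i by auto
  note b3 = block_3(1-4)[OF \<open>i + 3 \<le> k\<close> 0 1]
  note b4 = block_3(5)[OF \<open>i + 3 \<le> k\<close> 0 1 \<open>i + 4 \<le> k\<close>]
  have "2 * int (q (i + 5)) + X (i + 5) = 2 * int (s (i + 5)) + 2 - 2 * int m"
    using rec_q[of "i + 3"] i b3 b4 by (simp add: eval_nat_numeral)
  moreover have "2 * int (s (i + 5)) + Y (i + 5) = 2 * int m"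
    using rec_s[of "i + 3"] i b3 b4 by (simp add: eval_nat_numeral)
  moreover have "1 \<le> q (i + 5)" "0 \<le> X (i + 5)" "0 \<le> Y (i + 5)" using pos nonneg i by auto
  ultimately show "q (i + 5) = 1" "s (i + 5) = m" "X (i + 5) = 0" "Y (i + 5) = 0" by simp_all
qed

lemma block:
  "(4 * t \<le> k \<longrightarrow> q (4 * t) = 1 \<and> s (4 * t) = 1 \<and> X (4 * t) = 0 \<and> Y (4 * t) = 0) \<and>
   (4 * t + 1 \<le> k \<longrightarrow> q (4 * t + 1) = 1 \<and> s (4 * t + 1) = m \<and> X (4 * t + 1) = 0 \<and> Y (4 * t + 1) = 0)"
proof (induction t)
  case 0
  then show ?case using start by simp
next
  case (Suc t)
  have e: "4 * Suc t = 4 * t + 4" "4 * Suc t + 1 = 4 * t + 5" by auto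
  show ?case unfolding e
    using Suc block_3(5)[of "4 * t"] block_5[of "4 * t"] by (auto simp: add.commute)
qed

lemma pattern:
  assumes "i \<le> k"
  shows "q i = (if i mod 4 \<le> 1 then 1 else m)" "s i = (if Suc i mod 4 \<le> 1 then 1 else m)"
    "X i = 0" "Y i = 0"
proof -
  define t where "t = i div 4"
  have "i = 4 * t + i mod 4" by (simp add: t_def)
  moreover have "i mod 4 < 4" by simp
  ultimately consider "i = 4 * t" | "i = 4 * t + 1" | "i = 4 * t + 2" | "i = 4 * t + 3" by linarith
  then have "q i = (if i mod 4 \<le> 1 then 1 else m) \<and> s i = (if Suc i mod 4 \<le> 1 then 1 else m) \<and>
    X i = 0 \<and> Y i = 0"
  proof cases
    case 1 then show ?thesis using block[of t] assms by (simp add: mod_Suc)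
  next
    case 2 then show ?thesis using block[of t] assms by (simp add: mod_Suc)
  next
    case 3
    have "4 * t + 2 \<le> k" using 3 assms by simp
    note b = block_2(1-4)[OF this]
    show ?thesis using block[of t] assms 3 b by (simp add: mod_Suc)
  next
    case 4
    have "4 * t + 3 \<le> k" using 4 assms by simp
    note b = block_3(1-4)[OF this]
    show ?thesis using block[of t] assms 4 b by (simp add: mod_Suc)
  qed
  then show "q i = (if i mod 4 \<le> 1 then 1 else m)" "s i = (if Suc i mod 4 \<le> 1 then 1 else m)"
    "X i = 0" "Y i = 0" by blast+
qed

end

section \<open>The circular structure: \<open>A\<close>, \<open>B\<close> and two segments of equal
  length\<close>

text \<open>In cyclic order the graph consists of \<open>A\<close>, \<open>B\<close>, the segment
  \<open>Q\<close> from \<open>b\<close> to \<open>x\<close>, and the segment \<open>R\<close> from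
  \<open>y\<close> to \<open>a\<close>; the edge \<open>xy\<close> closes the circle. The structure
  is symmetric under exchanging \<open>A\<close> with \<open>B\<close>, \<open>Q\<close> with
  \<open>R\<close>, \<open>a\<close> with \<open>b\<close> and \<open>x\<close> with
  \<open>y\<close>.\<close>

locale necklace =
  balanced_metric +
  fixes A B Q R :: "'a set" and a b x y :: 'a and k m :: nat
  assumes V_eq: "V = A \<union> B \<union> Q \<union> R"
    and disj: "A \<inter> B = {}" "A \<inter> Q = {}" "A \<inter> R = {}" "B \<inter> Q = {}" "B \<inter> R = {}" "Q \<inter> R = {}"
    and card_AB: "card A = m" "card B = m" "1 \<le> m"
    and card_QR: "card Q = card R"
    and ends: "b \<in> Q" "x \<in> Q" "a \<in> R" "y \<in> R"
    and adj_A: "u \<in> A \<Longrightarrow> adj u w \<longleftrightarrow> w = a \<or> w \<in> B"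
    and adj_B: "u \<in> B \<Longrightarrow> adj u w \<longleftrightarrow> w = b \<or> w \<in> A"
    and adj_Q: "z \<in> Q \<Longrightarrow> adj z w \<Longrightarrow> w \<in> Q \<or> (z = b \<and> w \<in> B) \<or> (z = x \<and> w = y)"
    and adj_R: "z \<in> R \<Longrightarrow> adj z w \<Longrightarrow> w \<in> R \<or> (z = a \<and> w \<in> A) \<or> (z = y \<and> w = x)"
    and adj_xy: "adj x y"
    and d_ab: "d a b = 3"
    and sum_Q: "z \<in> Q \<Longrightarrow> d z b + d z x = k"
    and sum_R: "z \<in> R \<Longrightarrow> d z a + d z y = k"
    and d_by: "d b y = k + 1"
    and d_ax: "d a x = k + 1"
    and k_pos: "1 \<le> k"
begin

lemma in_V: "z \<in> A \<Longrightarrow> z \<in> V" "z \<in> B \<Longrightarrow> z \<in> V" "z \<in> Q \<Longrightarrow> z \<in> V" "z \<in> R \<Longrightarrow> z \<in> V"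
  "a \<in> V" "b \<in> V" "x \<in> V" "y \<in> V"
  using V_eq ends by auto

lemma swap: "necklace V adj d B A R Q b a y x k m"
proof -
  have "V = B \<union> A \<union> R \<union> Q" "adj y x" "d b a = 3"
    using V_eq adj_xy d_ab d_sym[of a b] in_V by (auto intro: adj_sym)
  then show ?thesis
    using disj card_AB card_QR ends adj_A adj_B adj_Q adj_R sum_Q sum_R d_by d_ax k_pos
    by unfold_locales (simp_all add: Int_commute)
qed

lemma finite_parts: "finite A" "finite B" "finite Q" "finite R"
  using finite_V V_eq by auto

lemma nonempty_AB: "A \<noteq> {}" "B \<noteq> {}"
  using card_AB by auto

lemma d_A:
  assumes "u \<in> A"
  shows "d u a = 1" "d u b = 2"
proof -
  show "d u a = 1" using adj_A adj_d assms by blast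
  obtain v where v: "v \<in> B" using nonempty_AB by blast
  have "d u v = 1" "d v b = 1" using adj_A[OF assms] adj_B[OF v] adj_d v by auto
  then have "d u b \<le> 2" using d_triangle[of u v b] in_V(1)[OF assms] in_V(2)[OF v] in_V(6) by simp
  moreover have "u \<noteq> b" "b \<noteq> a" "b \<notin> B" using assms ends disj by auto
  then have "d u b \<noteq> 0" "d u b \<noteq> 1"
    using d_eq_0[of u b] d_eq_1[of u b] adj_A[OF assms, of b] in_V(1)[OF assms] in_V(6) by auto
  ultimately show "d u b = 2" by linarith
qed

lemma d_B:
  assumes "v \<in> B"
  shows "d v b = 1" "d v a = 2"
  using necklace.d_A[OF swap assms] by auto

lemma d_AB_out:
  assumes "u \<in> A \<union> B" "z \<in> Q \<union> R"
  shows "d u z = min (d u a + d a z) (d u b + d b z)"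
proof -
  have "\<exists>s\<in>{a, b}. d u z = d u s + d s z"
  proof (rule d_via_separator[of "A \<union> B"])
    show "v \<in> A \<union> B \<union> {a, b}" if "u \<in> A \<union> B" "adj u v" for u v
      using adj_A[of u v] adj_B[of u v] that by blast
    show "z \<in> V - (A \<union> B)" using assms(2) V_eq disj by blast
  qed (use V_eq assms in_V(5,6) in auto)
  moreover have "u \<in> V" "z \<in> V" using assms V_eq by auto
  then have "d u z \<le> d u a + d a z" "d u z \<le> d u b + d b z"
    using d_triangle in_V(5,6) by auto
  ultimately show ?thesis by auto
qed

lemma d_Q_out:
  assumes "z \<in> Q" "p \<in> V - Q"
  shows "\<exists>s\<in>{b, x}. d z p = d z s + d s p"
proof (cases "z = b \<or> z = x")
  case True
  then show ?thesis using d_eq_0[of z z] in_V(6,7) by auto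
next
  case False
  show ?thesis
    by (rule d_via_separator[of "Q - {b, x}"]) (use adj_Q False assms in_V(3,6,7) in \<open>blast+\<close>)
qed

text \<open>A geodesic leaves \<open>Q\<close> at \<open>b\<close> or \<open>x\<close> and enters
  \<open>R\<close> at \<open>a\<close> or \<open>y\<close>. The pairs \<open>b\<close>,
  \<open>y\<close> and \<open>x\<close>, \<open>a\<close> are at distance \<open>k + 1\<close>, the
  length of a segment plus the edge \<open>xy\<close>, so they never beat the route through
  \<open>xy\<close>.\<close>

lemma d_QR:
  assumes z: "z \<in> Q" and p: "p \<in> R"
  shows "d z p = min (d z b + 3 + d p a) (d z x + 1 + d p y)"
proof -
  have V: "z \<in> V" "p \<in> V" using z p in_V by auto
  have sym: "d b a = 3" "d x a = k + 1" "d y b = k + 1" "d x y = 1"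
    "d a p = d p a" "d y p = d p y" "d b z = d z b" "d x z = d z x"
    using d_ab d_ax d_by d_sym in_V(5-8) V adj_d[OF adj_xy] by auto
  have "p \<in> V - Q" using V p disj(6) by auto
  then obtain s where s: "s \<in> {b, x}" "d z p = d z s + d s p" using d_Q_out[OF z] by blast
  have "s \<in> V - R" using s(1) in_V(6,7) ends(1,2) disj(6) by auto
  then obtain t where t: "t \<in> {a, y}" "d p s = d p t + d t s"
    using necklace.d_Q_out[OF swap p] by blast
  have "d s p = d p t + d s t"
    using t s(1) d_sym[of s p] d_sym[of t s] in_V(5-8) V(2) by auto
  then have eq: "d z p = d z s + d s t + d p t" using s by simp
  have "d z p \<le> d z b + d b a + d a p" "d z p \<le> d z x + d x y + d y p"
    using d_triangle[of z b p] d_triangle[of b a p] d_triangle[of z x p] d_triangle[of x y p]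
      in_V(5-8) V by simp_all
  moreover have "d p y \<le> k + d p a" "d z x \<le> k + d z b"
    using sum_R[OF p] sum_Q[OF z] by linarith+
  ultimately show ?thesis using s(1) t(1) eq sym d_by d_ab by auto
qed

lemma d_Qa: "z \<in> Q \<Longrightarrow> d z b < d a z"
  using d_QR[of z a] ends sum_Q[of z] sum_R[of a] k_pos d_eq_0[of a a] in_V(3,5) d_sym[of z a] by auto

lemma d_QB:
  assumes "z \<in> Q" "v \<in> B"
  shows "d z v = d z b + 1"
  using d_AB_out[of v z] d_Qa[of z] assms d_B[of v] d_sym[of z v] d_sym[of z b]
    in_V(2,3,6) by auto

lemma d_QA:
  assumes "z \<in> Q" "u \<in> A"
  shows "d z u = d z b + 2"
  using d_AB_out[of u z] d_Qa[of z] assms d_A[of u] d_sym[of z u] d_sym[of z b]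
    in_V(1,3,6) by auto

lemma segment_Q: "segment V adj d Q b x k"
proof unfold_locales
  show "Q \<subseteq> V" using in_V by blast
  fix z assume z: "z \<in> Q"
  note zk = sum_Q[OF z]
  show "\<exists>w\<in>Q. adj z w \<and> d z b = Suc (d w b)" if ne: "z \<noteq> b"
  proof -
    obtain w where w: "adj z w" "d z b = Suc (d w b)" using d_step[of z b] ne z in_V by blast
    have "\<not> (z = x \<and> w = y)" using d_by d_sym[of y b] in_V w zk by auto
    then show ?thesis using w adj_Q[OF z w(1)] ne by blast
  qed
  show "\<exists>w\<in>Q. adj z w \<and> d z x = Suc (d w x)" if ne: "z \<noteq> x"
  proof -
    obtain w where w: "adj z w" "d z x = Suc (d w x)" using d_step[of z x] ne z in_V by blast
    have "w \<notin> B" using d_QB[of x w] ends sum_Q[of x] w zk d_eq_0[of x x] d_sym[of w x] in_V by auto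
    then show ?thesis using w adj_Q[OF z w(1)] ne by blast
  qed
qed (use ends sum_Q in auto)

sublocale Q: segment V adj d Q b x k
  by (rule segment_Q)

sublocale R: segment V adj d R a y k
  by (rule necklace.segment_Q[OF swap])

lemma card_V: "card V = 2 * m + 2 * card Q"
proof -
  have "card V = card (A \<union> B \<union> Q) + card R" unfolding V_eq
    using finite_parts disj by (intro card_Un_disjoint) auto
  also have "card (A \<union> B \<union> Q) = card (A \<union> B) + card Q"
    using finite_parts disj by (intro card_Un_disjoint) auto
  also have "card (A \<union> B) = card A + card B"
    using finite_parts disj by (intro card_Un_disjoint) auto
  finally show ?thesis using card_AB card_QR by simp
qed

text \<open>Vertices of \<open>A\<close> and \<open>B\<close> are reached through \<open>b\<close>,
  so none is closer to \<open>w\<close>. If \<open>z\<close> is in level \<open>i\<close> and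
  \<open>p\<close> in level \<open>j\<close> of \<open>R\<close>, the routes from \<open>z\<close>
  to \<open>p\<close> have lengths \<open>i + j + 3\<close> and \<open>2 * k + 1 - i - j\<close>;
  \<open>w\<close> is closer exactly when the second is not the longer one, which is
  \<open>k < j + i + 2\<close>. The rest is the balance condition with
  \<open>card Q = card R\<close>.\<close>

lemma count_edge:
  assumes zw: "z \<in> Q" "w \<in> Q" "adj z w" "d w b = Suc (d z b)"
  shows "card {p \<in> Q. d w p < d z p} = m + card {p \<in> R. d p a + d z b + 2 \<le> k}"
proof -
  note lev = sum_Q[OF zw(1)] sum_Q[OF zw(2)]
  have "{p \<in> V. d w p < d z p} = {p \<in> Q. d w p < d z p} \<union> {p \<in> R. k < d p a + d z b + 2}"
    (is "?L = ?M")
  proof -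
    have "p \<in> ?L \<longleftrightarrow> p \<in> ?M" if pV: "p \<in> V" for p
    proof -
      consider "p \<in> A" | "p \<in> B" | "p \<in> Q" | "p \<in> R" using pV V_eq by blast
      then show ?thesis
      proof cases
        case 1
        then have "p \<notin> Q" "p \<notin> R" using disj by auto
        then show ?thesis using 1 d_QA[OF zw(1) 1] d_QA[OF zw(2) 1] zw by auto
      next
        case 2
        then have "p \<notin> Q" "p \<notin> R" using disj by auto
        then show ?thesis using 2 d_QB[OF zw(1) 2] d_QB[OF zw(2) 2] zw by auto
      next
        case 3
        then have "p \<notin> R" using disj by auto
        then show ?thesis using 3 pV by auto
      next
        case 4
        then have "p \<notin> Q" using disj by auto
        moreover have "d w p < d z p \<longleftrightarrow> k < d p a + d z b + 2"
          using d_QR[OF zw(1) 4] d_QR[OF zw(2) 4] zw(4) lev sum_R[OF 4]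
            d_adj_neq[OF zw(3) pV] by (auto simp: min_def)
        ultimately show ?thesis using 4 pV by auto
      qed
    qed
    moreover have "?M \<subseteq> V" using in_V by blast
    ultimately show ?thesis by blast
  qed
  moreover have "card ?M = card {p \<in> Q. d w p < d z p} + card {p \<in> R. k < d p a + d z b + 2}"
    using finite_parts disj by (intro card_Un_disjoint) auto
  ultimately have 1: "m + card Q = card {p \<in> Q. d w p < d z p} + card {p \<in> R. k < d p a + d z b + 2}"
    using card_closer[OF adj_sym[OF zw(3)]] card_V by simp
  have "R = {p \<in> R. k < d p a + d z b + 2} \<union> {p \<in> R. d p a + d z b + 2 \<le> k}" by auto
  moreover have "card ({p \<in> R. k < d p a + d z b + 2} \<union> {p \<in> R. d p a + d z b + 2 \<le> k}) =
      card {p \<in> R. k < d p a + d z b + 2} + card {p \<in> R. d p a + d z b + 2 \<le> k}"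
    using finite_parts by (intro card_Un_disjoint) auto
  ultimately have "card R = card {p \<in> R. k < d p a + d z b + 2} + card {p \<in> R. d p a + d z b + 2 \<le> k}"
    by simp
  then show ?thesis using 1 card_QR by simp
qed

lemma excess_edge:
  assumes zw: "z \<in> Q" "w \<in> Q" "adj z w" "d w b = Suc (d z b)"
  shows "Q.excess z - Q.excess w = 2 * int m + 2 * int (card {p \<in> R. d p a + d z b + 2 \<le> k})
    - 2 * int (card (Q.level (d z b))) - 2 * int (card {p \<in> Q. d z b + 2 \<le> d p b})"
  using Q.excess_diff[OF assms] count_edge[OF assms] by simp

text \<open>The change of the excess given by \<open>excess_edge\<close> depends only on the level,
  and all descents end in the same vertex \<open>b\<close>.\<close>

lemma excess_const:
  assumes "z \<in> Q" "w \<in> Q" "d z b = d w b"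
  shows "Q.excess z = Q.excess w"
  using assms
proof (induction "d z b" arbitrary: z w)
  case 0
  then show ?case using d_eq_0 in_V by metis
next
  case (Suc i)
  have "z \<noteq> b" "w \<noteq> b" using Suc.hyps(2) Suc.prems(3) d_eq_0[of b b] in_V(6) by auto
  then obtain z' w' where z': "z' \<in> Q" "adj z z'" "d z b = Suc (d z' b)"
      and w': "w' \<in> Q" "adj w w'" "d w b = Suc (d w' b)"
    using Q.down Suc.prems(1,2) by meson
  have eq: "d z' b = d w' b" "i = d z' b" using Suc.hyps(2) Suc.prems(3) z' w' by auto
  then have "Q.excess z' = Q.excess w'" using Suc.hyps(1) z'(1) w'(1) by blast
  then show ?case
    using excess_edge[OF z'(1) Suc.prems(1) adj_sym[OF z'(2)] z'(3)]
      excess_edge[OF w'(1) Suc.prems(2) adj_sym[OF w'(2)] w'(3)] eq(1) by simp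
qed

text \<open>Any representative of the level serves, by \<open>excess_const\<close>.\<close>

definition X :: "nat \<Rightarrow> int" where
  "X i = Q.excess (SOME z. z \<in> Q.level i)"

lemma excess_X: "z \<in> Q \<Longrightarrow> Q.excess z = X (d z b)"
proof -
  assume z: "z \<in> Q"
  define w where "w = (SOME w. w \<in> Q.level (d z b))"
  have "w \<in> Q.level (d z b)"
    unfolding w_def by (rule someI[of _ z]) (simp add: Q.level_def z)
  then have "Q.excess z = Q.excess w" using z by (intro excess_const) (auto simp: Q.level_def)
  then show ?thesis by (simp add: X_def w_def)
qed

lemma X_nonneg: "i \<le> k \<Longrightarrow> 0 \<le> X i"
proof -
  assume "i \<le> k"
  then obtain z where "z \<in> Q" "d z b = i" using Q.level_nonempty[of i] by (auto simp: Q.level_def)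
  then show ?thesis using excess_X[of z] Q.excess_nonneg[of z] by simp
qed

lemma X_ends: "X 0 = 0" "X k = 0"
  using Q.excess_single_level[OF excess_X] Q.level_0 Q.level_k by simp_all

lemma X_edge:
  assumes "i < k"
  shows "X i - X (Suc i) = 2 * int m + 2 * int (card {p \<in> R. d p a + i + 2 \<le> k})
    - 2 * int (card (Q.level i)) - 2 * int (card {p \<in> Q. i + 2 \<le> d p b})"
proof -
  obtain w where w: "w \<in> Q" "d w b = Suc i"
    using Q.level_nonempty[of "Suc i"] assms by (auto simp: Q.level_def)
  then have "w \<noteq> b" using d_eq_0[of b b] in_V by auto
  then obtain z where z: "z \<in> Q" "adj w z" "d w b = Suc (d z b)" using Q.down w by blast
  then have "d z b = i" using w by simp
  then show ?thesis
    using excess_edge[OF z(1) w(1) adj_sym[OF z(2)] z(3)] excess_X[OF z(1)] excess_X[OF w(1)] w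
    by simp
qed

text \<open>In the difference of \<open>X_edge\<close> at \<open>i\<close> and at
  \<open>i + 1\<close>, each of the two cumulative counts reduces to a single level.\<close>

lemma X_second_diff:
  assumes "i + 2 \<le> k"
  shows "2 * int (card (Q.level i)) - 2 * int (card (Q.level (i + 1))) + 2 * int (card (Q.level (i + 2)))
     + X i - 2 * X (i + 1) + X (i + 2) = 2 * int (card (R.level (k - (i + 2))))"
proof -
  have "{p \<in> Q. i + 2 \<le> d p b} = Q.level (i + 2) \<union> {p \<in> Q. Suc i + 2 \<le> d p b}"
    by (auto simp: Q.level_def)
  moreover have "card (Q.level (i + 2) \<union> {p \<in> Q. Suc i + 2 \<le> d p b}) =
      card (Q.level (i + 2)) + card {p \<in> Q. Suc i + 2 \<le> d p b}"
    using finite_parts by (intro card_Un_disjoint) (auto simp: Q.level_def)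
  moreover have "{p \<in> R. d p a + i + 2 \<le> k} =
      R.level (k - (i + 2)) \<union> {p \<in> R. d p a + Suc i + 2 \<le> k}"
    using assms by (auto simp: R.level_def)
  moreover have "card (R.level (k - (i + 2)) \<union> {p \<in> R. d p a + Suc i + 2 \<le> k}) =
      card (R.level (k - (i + 2))) + card {p \<in> R. d p a + Suc i + 2 \<le> k}"
    using finite_parts assms by (intro card_Un_disjoint) (auto simp: R.level_def)
  ultimately show ?thesis using X_edge[of i] X_edge[of "Suc i"] assms by simp
qed

lemma X_last: "2 * int (card (Q.level (k - 1))) + X (k - 1) = 2 * int m"
proof -
  have "{p \<in> R. d p a + (k - 1) + 2 \<le> k} = {}" using k_pos by auto
  then have "card {p \<in> R. d p a + (k - 1) + 2 \<le> k} = 0" by (simp only: card.empty)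
  moreover have "{p \<in> Q. (k - 1) + 2 \<le> d p b} = {}" using Q.level_le k_pos by fastforce
  then have "card {p \<in> Q. (k - 1) + 2 \<le> d p b} = 0" by (simp only: card.empty)
  moreover have "X (Suc (k - 1)) = 0" using k_pos X_ends by simp
  moreover have "k - 1 < k" using k_pos by simp
  ultimately show ?thesis using X_edge[of "k - 1"] by linarith
qed

text \<open>This is \<open>X_edge\<close> at \<open>b\<close>; both cumulative counts are taken as
  complements in \<open>Q\<close> and \<open>R\<close>, whose sizes agree and cancel.\<close>

lemma X_first:
  "2 * int (card (Q.level 1)) + X 1 + 2 * int m = 2 + 2 * int (card (R.level (k - 1)))"
proof -
  have "{p \<in> R. d p a + 2 \<le> k} = R - (R.level k \<union> R.level (k - 1))"
  proof -
    have "d p a + 2 \<le> k \<longleftrightarrow> d p a \<noteq> k \<and> d p a \<noteq> k - 1" if "p \<in> R" for p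
      using R.level_le[OF that] k_pos by linarith
    then show ?thesis by (auto simp: R.level_def)
  qed
  moreover have "card (R - (R.level k \<union> R.level (k - 1))) =
      card R - card (R.level k \<union> R.level (k - 1))"
    using R.finite_level by (intro card_Diff_subset) (auto simp: R.level_def)
  moreover have "card (R.level k \<union> R.level (k - 1)) \<le> card R"
    using finite_parts by (intro card_mono) (auto simp: R.level_def)
  moreover have "card (R.level k \<union> R.level (k - 1)) = card (R.level k) + card (R.level (k - 1))"
    using R.finite_level k_pos by (intro card_Un_disjoint) (auto simp: R.level_def)
  moreover have "card (R.level k) = 1" using R.level_k by simp
  ultimately have r: "card {p \<in> R. d p a + 2 \<le> k} + 1 + card (R.level (k - 1)) = card R"
    by simp
  have "{p \<in> Q. 2 \<le> d p b} = Q - (Q.level 0 \<union> Q.level 1)"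
    by (auto simp: Q.level_def)
  moreover have "card (Q - (Q.level 0 \<union> Q.level 1)) = card Q - card (Q.level 0 \<union> Q.level 1)"
    using Q.finite_level by (intro card_Diff_subset) (auto simp: Q.level_def)
  moreover have "card (Q.level 0 \<union> Q.level 1) \<le> card Q"
    using finite_parts by (intro card_mono) (auto simp: Q.level_def)
  moreover have "card (Q.level 0 \<union> Q.level 1) = card (Q.level 0) + card (Q.level 1)"
    using Q.finite_level by (intro card_Un_disjoint) (auto simp: Q.level_def)
  moreover have "card (Q.level 0) = 1" using Q.level_0 by simp
  ultimately have q: "card {p \<in> Q. 2 \<le> d p b} + 1 + card (Q.level 1) = card Q"
    by simp
  have "X 0 - X 1 = 2 * int m + 2 * int (card {p \<in> R. d p a + 2 \<le> k}) - 2
      - 2 * int (card {p \<in> Q. 2 \<le> d p b})"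
    using X_edge[of 0] k_pos Q.level_0 by (simp add: numeral_2_eq_2)
  then show ?thesis using X_ends(1) q r card_QR by linarith
qed

abbreviation Y :: "nat \<Rightarrow> int" where
  "Y \<equiv> necklace.X d R a"

text \<open>Eliminating \<open>card (R.level (k - 1))\<close> between \<open>X_first\<close> and
  \<open>X_last\<close> for the opposite segment leaves
  \<open>2 * card (Q.level 1) + X 1 + Y (k - 1) = 2\<close>.\<close>

lemma first_last:
  "card (Q.level 1) = 1" "X 1 = 0" "card (R.level (k - 1)) = m" "Y (k - 1) = 0"
proof -
  have "1 \<le> card (Q.level 1)" "0 \<le> X 1" "0 \<le> Y (k - 1)"
    using Q.card_level_pos X_nonneg necklace.X_nonneg[OF swap] k_pos by auto
  then have "card (Q.level 1) = 1 \<and> X 1 = 0 \<and> Y (k - 1) = 0"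
    using X_first necklace.X_last[OF swap] by linarith
  then show "card (Q.level 1) = 1" "X 1 = 0" "card (R.level (k - 1)) = m" "Y (k - 1) = 0"
    using necklace.X_last[OF swap] by auto
qed

text \<open>The levels of \<open>R\<close> are enumerated from the far end \<open>y\<close>, which is antipodal to \<open>b\<close>.\<close>

lemma recursion:
  "level_recursion k m (\<lambda>i. card (Q.level i)) (\<lambda>i. card (R.level (k - i))) X (\<lambda>i. Y (k - i))"
proof
  \<comment> \<open>The collapse for \<open>R\<close> has to run upwards from \<open>y\<close>, so
    \<open>R\<close> is read from that end.\<close>
  interpret S: segment V adj d R y a k by (rule R.reverse)
  have S_level: "S.level i = R.level (k - i)" if "i \<le> k" for i
    using R.level_reverse[OF that] .
  have S_excess: "S.excess z = Y (k - d z y)" if "z \<in> R" for z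
  proof -
    have "k - d z y = d z a" using sum_R[OF that] by linarith
    then show ?thesis using R.excess_reverse[OF that] necklace.excess_X[OF swap that] by simp
  qed
  show "1 \<le> k" by (rule k_pos)
  show "1 \<le> card (Q.level i)" "0 \<le> X i" if "i \<le> k" for i
    using that Q.card_level_pos X_nonneg by auto
  show "1 \<le> card (R.level (k - i))" "0 \<le> Y (k - i)" if "i \<le> k" for i
    using R.card_level_pos necklace.X_nonneg[OF swap] by auto
  show "card (Q.level 0) = 1" "card (R.level (k - 0)) = 1" using Q.level_0 R.level_k by simp_all
  show "card (Q.level 1) = 1" "X 1 = 0" "card (R.level (k - 1)) = m" "Y (k - 1) = 0"
    by (fact first_last)+
  show "X (k - 1) = 0" by (rule necklace.first_last(4)[OF swap])
  show "X 0 = 0" "X k = 0" by (fact X_ends)+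
  show "Y (k - 0) = 0" "Y (k - k) = 0" using necklace.X_ends[OF swap] by simp_all
  fix i assume i: "i + 2 \<le> k"
  show "2 * int (card (Q.level i)) - 2 * int (card (Q.level (i + 1)))
      + 2 * int (card (Q.level (i + 2))) + X i - 2 * X (i + 1) + X (i + 2)
    = 2 * int (card (R.level (k - (i + 2))))"
    by (rule X_second_diff[OF i])
  have k: "k - (i + 2) + 1 = k - (i + 1)" "k - (i + 2) + 2 = k - i"
    "k - (k - i) = i" "k - (i + 2) + 2 \<le> k"
    using i by auto
  show "2 * int (card (R.level (k - i))) - 2 * int (card (R.level (k - (i + 1))))
      + 2 * int (card (R.level (k - (i + 2)))) + Y (k - i) - 2 * Y (k - (i + 1)) + Y (k - (i + 2))
    = 2 * int (card (Q.level i))"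
    using necklace.X_second_diff[OF swap k(4)] unfolding k by linarith
  show "card (Q.level (i + 2)) = 1 \<and> X (i + 1) = 0 \<and> X (i + 2) = 0"
    if "X i = 0" "2 * int (card (Q.level (i + 2))) + X (i + 2) = 2 + X (i + 1)"
    using Q.level_collapse[OF excess_X, of i] that i by simp
  show "card (R.level (k - (i + 2))) = 1 \<and> Y (k - (i + 1)) = 0 \<and> Y (k - (i + 2)) = 0"
    if "Y (k - i) = 0"
      "2 * int (card (R.level (k - (i + 2)))) + Y (k - (i + 2)) = 2 + Y (k - (i + 1))"
    using S.level_collapse[where X = "\<lambda>i. Y (k - i)", OF S_excess, of i] that i S_level by simp
qed

lemma card_Q_level: "i \<le> k \<Longrightarrow> card (Q.level i) = (if i mod 4 \<le> 1 then 1 else m)"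
  by (rule level_recursion.pattern(1)[OF recursion])

text \<open>At \<open>i = k\<close> both sequences end in single vertices, \<open>x\<close> and
  \<open>a\<close>. Unless \<open>m = 1\<close>, the pattern then requires \<open>k\<close> and
  \<open>k + 1\<close> to have residue 0 or 1 modulo 4.\<close>

lemma period: "m = 1 \<or> 4 dvd k"
proof -
  have "(if k mod 4 \<le> 1 then 1 else m) = 1" "(if Suc k mod 4 \<le> 1 then 1 else m) = 1"
    using level_recursion.pattern(1,2)[OF recursion, of k] Q.level_k R.level_0 by simp_all
  then have "m = 1 \<or> k mod 4 \<le> 1 \<and> Suc k mod 4 \<le> 1" by metis
  then show ?thesis by presburger
qed

text \<open>All excesses vanish by the recursion, so distances equal gaps, and consecutive levels
  are completely joined.\<close>

lemma adj_Q_iff: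
  assumes "z \<in> Q" "w \<in> Q"
  shows "adj z w \<longleftrightarrow> d z b = Suc (d w b) \<or> d w b = Suc (d z b)"
proof -
  have "Q.excess p = 0" if "p \<in> Q" for p
    using excess_X[OF that] level_recursion.pattern(3)[OF recursion] Q.level_le[OF that] by simp
  then show ?thesis
    using Q.adj_in_level[OF assms] Q.complete_below assms adj_sym by metis
qed

text \<open>A coordinate on the circle: \<open>a\<close> at 0, \<open>A\<close> at 1,
  \<open>B\<close> at 2, \<open>Q\<close> from 3 to \<open>k + 3\<close>, and \<open>R\<close> from
  \<open>y\<close> at \<open>k + 4\<close> upwards back to \<open>a\<close>. The reduction modulo
  \<open>2 * k + 4\<close> matters only for \<open>a\<close>.\<close>

definition position :: "'a \<Rightarrow> nat" where
  "position u = (if u \<in> A then 1 else if u \<in> B then 2 else if u \<in> Q then 3 + d u b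
     else (2 * k + 4 - d u a) mod (2 * k + 4))"

lemma position_AB: "u \<in> A \<Longrightarrow> position u = 1" "u \<in> B \<Longrightarrow> position u = 2"
  using disj by (auto simp: position_def)

lemma position_Q: "u \<in> Q \<Longrightarrow> position u = 3 + d u b \<and> d u b \<le> k"
  using disj Q.level_le by (auto simp: position_def)

lemma position_R:
  assumes "u \<in> R"
  shows "u = a \<and> position u = 0 \<and> d u a = 0 \<or>
    u \<noteq> a \<and> position u = 2 * k + 4 - d u a \<and> 1 \<le> d u a \<and> d u a \<le> k"
proof -
  have "u \<notin> A" "u \<notin> B" "u \<notin> Q" using assms disj by auto
  then have p: "position u = (2 * k + 4 - d u a) mod (2 * k + 4)" by (simp add: position_def)
  have "d u a = 0 \<longleftrightarrow> u = a" using d_eq_0[of u a] in_V(4)[OF assms] in_V(5) by simp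
  then show ?thesis using p R.level_le[OF assms] by (cases "u = a") auto
qed

lemma position_less: "u \<in> V \<Longrightarrow> position u < 2 * k + 4"
  using V_eq position_AB[of u] position_Q[of u] position_R[of u] by fastforce

lemma adj_iff_position:
  assumes "u \<in> V" "v \<in> V"
  shows "adj u v \<longleftrightarrow> Suc (position u) mod (2 * k + 4) = position v \<or>
    Suc (position v) mod (2 * k + 4) = position u"
proof -
  \<comment> \<open>Cyclic adjacency without \<open>mod\<close>, so that the cases are linear
    arithmetic; the return to \<open>mod\<close> comes at the end.\<close>
  define C where "C i j \<longleftrightarrow> Suc i = j \<or> Suc j = i \<or> i = 0 \<and> j = 2 * k + 3 \<or> j = 0 \<and> i = 2 * k + 3"
    for i j
  have C_sym: "C i j \<longleftrightarrow> C j i" for i j by (auto simp: C_def)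
  have C_QQ: "C (3 + i) (3 + j) \<longleftrightarrow> i = Suc j \<or> j = Suc i" for i j
    unfolding C_def by presburger
  have C_QR0: "\<not> C (3 + i) 0" if "i \<le> k" for i
    using that k_pos unfolding C_def by presburger
  have C_QR: "C (3 + i) (2 * k + 4 - j) \<longleftrightarrow> i = k \<and> j = k" if "i \<le> k" "1 \<le> j" "j \<le> k" for i j
    using that unfolding C_def by auto
  have C_R0: "1 \<le> j \<Longrightarrow> j \<le> k \<Longrightarrow> C 0 (2 * k + 4 - j) \<longleftrightarrow> j = 1" "\<not> C 0 0" for j
    unfolding C_def by presburger+
  have C_RR: "C (2 * k + 4 - i) (2 * k + 4 - j) \<longleftrightarrow> i = Suc j \<or> j = Suc i"
    if "1 \<le> i" "i \<le> k" "1 \<le> j" "j \<le> k" for i j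
    using that unfolding C_def by auto
  have adj_comm: "adj p q \<longleftrightarrow> adj q p" for p q using adj_sym by blast
  have QR: "adj p q \<longleftrightarrow> p = x \<and> q = y" if "p \<in> Q" "q \<in> R" for p q
    using adj_Q[of p q] adj_xy that disj by auto
  have lev_x: "d p b = k \<longleftrightarrow> p = x" if "p \<in> Q" for p
    using Q.level_k that by (auto simp: Q.level_def)
  have lev_y: "d p a = k \<longleftrightarrow> p = y" if "p \<in> R" for p
    using R.level_k that by (auto simp: R.level_def)
  have lev_b: "d p b = 0 \<longleftrightarrow> p = b" if "p \<in> Q" for p
    using Q.level_0 that by (auto simp: Q.level_def)
  have A: "adj p q \<longleftrightarrow> C (position p) (position q)" if p: "p \<in> A" and q: "q \<in> V" for p q
  proof -
    consider "q \<in> A" | "q \<in> B" | "q \<in> Q" | "q \<in> R" using q V_eq by blast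
    then show ?thesis
    proof cases
      case 1
      then have "q \<noteq> a" "q \<notin> B" using ends(3) disj by auto
      then show ?thesis using adj_A[OF p, of q] position_AB(1) p 1 by (simp add: C_def)
    next
      case 2
      then show ?thesis using adj_A[OF p, of q] position_AB p by (simp add: C_def)
    next
      case 3
      then have "q \<noteq> a" "q \<notin> B" using ends(3) disj by auto
      then show ?thesis using adj_A[OF p, of q] position_AB(1)[OF p] position_Q[OF 3] by (simp add: C_def)
    next
      case 4
      then have "q \<notin> B" using disj by auto
      then show ?thesis
        using adj_A[OF p, of q] position_AB(1)[OF p] position_R[OF 4] by (auto simp: C_def)
    qed
  qed
  have B: "adj p q \<longleftrightarrow> C (position p) (position q)" if p: "p \<in> B" and q: "q \<in> B \<union> Q \<union> R" for p q
  proof -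
    consider "q \<in> B" | "q \<in> Q" | "q \<in> R" using q by blast
    then show ?thesis
    proof cases
      case 1
      then have "q \<noteq> b" "q \<notin> A" using ends(1) disj by auto
      then show ?thesis using adj_B[OF p, of q] position_AB(2) p 1 by (simp add: C_def)
    next
      case 2
      then have "q \<notin> A" using disj by auto
      then show ?thesis using adj_B[OF p, of q] position_AB(2)[OF p] position_Q[OF 2] lev_b[OF 2]
        by (auto simp: C_def)
    next
      case 3
      then have "q \<noteq> b" "q \<notin> A" using ends(1) disj by auto
      then show ?thesis
        using adj_B[OF p, of q] position_AB(2)[OF p] position_R[OF 3] k_pos by (auto simp: C_def)
    qed
  qed
  have Q: "adj p q \<longleftrightarrow> C (position p) (position q)" if p: "p \<in> Q" and q: "q \<in> Q \<union> R" for p q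
  proof (cases "q \<in> Q")
    case True
    then show ?thesis using adj_Q_iff[OF p True] position_Q[OF p] position_Q[OF True] C_QQ by simp
  next
    case False
    then have q: "q \<in> R" using q by blast
    show ?thesis
    proof (cases "q = a")
      case True
      then have "q \<noteq> y" using lev_y[OF q] position_R[OF q] k_pos by auto
      then show ?thesis using True QR[OF p q] position_Q[OF p] position_R[OF q] C_QR0 by simp
    next
      case False
      then show ?thesis
        using QR[OF p q] lev_x[OF p] lev_y[OF q] position_Q[OF p] position_R[OF q] C_QR by simp
    qed
  qed
  have R: "adj p q \<longleftrightarrow> C (position p) (position q)" if p: "p \<in> R" and q: "q \<in> R" for p q
  proof -
    note pq = necklace.adj_Q_iff[OF swap p q] position_R[OF p] position_R[OF q]
    show ?thesis
    proof (cases "p = a")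
      case True
      show ?thesis
      proof (cases "q = a")
        case True
        then show ?thesis using \<open>p = a\<close> pq C_R0(2) by simp
      next
        case False
        then show ?thesis using \<open>p = a\<close> pq C_R0(1)[of "d q a"] by simp
      qed
    next
      case False
      then show ?thesis
        using pq C_R0(1)[of "d p a"] C_sym[of 0] C_RR[of "d p a" "d q a"] by (cases "q = a") simp_all
    qed
  qed
  have "adj u v \<longleftrightarrow> C (position u) (position v)"
  proof -
    have P: "adj u v \<longleftrightarrow> C (position u) (position v)" if "adj v u \<longleftrightarrow> C (position v) (position u)"
      using that adj_comm[of u v] C_sym[of "position u"] by simp
    have "u \<in> A \<or> u \<in> B \<or> u \<in> Q \<or> u \<in> R" "v \<in> A \<or> v \<in> B \<or> v \<in> Q \<or> v \<in> R"
      using assms V_eq by auto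
    then consider "u \<in> A" | "v \<in> A" | "u \<in> B" "v \<in> B \<union> Q \<union> R" | "v \<in> B" "u \<in> B \<union> Q \<union> R" |
      "u \<in> Q" "v \<in> Q \<union> R" | "v \<in> Q" "u \<in> Q \<union> R" | "u \<in> R" "v \<in> R" by blast
    then show ?thesis
    proof cases
      case 1 then show ?thesis by (rule A[OF _ assms(2)])
    next
      case 2 then show ?thesis by (rule P[OF A[OF _ assms(1)]])
    next
      case 3 then show ?thesis by (rule B)
    next
      case 4 then show ?thesis by (rule P[OF B])
    next
      case 5 then show ?thesis by (rule Q)
    next
      case 6 then show ?thesis by (rule P[OF Q])
    next
      case 7 then show ?thesis by (rule R)
    qed
  qed
  moreover have "C (position u) (position v) \<longleftrightarrow> Suc (position u) mod (2 * k + 4) = position v \<or>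
    Suc (position v) mod (2 * k + 4) = position u"
  proof -
    have "Suc i mod (2 * k + 4) = (if i = 2 * k + 3 then 0 else Suc i)" if "i < 2 * k + 4" for i
    proof (cases "i = 2 * k + 3")
      case True
      then have "Suc i = 2 * k + 4" by simp
      then show ?thesis using True by (simp only: mod_self simp_thms if_True)
    qed (use that in simp)
    then show ?thesis
      using position_less[OF assms(1)] position_less[OF assms(2)] by (auto simp: C_def)
  qed
  ultimately show ?thesis by simp
qed

lemma card_position:
  assumes "i < 2 * k + 4"
  shows "card {u \<in> V. position u = i} = (if i mod 4 = 0 \<or> i mod 4 = 3 then 1 else m)"
proof -
  consider "i = 0" | "i = 1" | "i = 2" | "3 \<le> i" "i \<le> k + 3" | "k + 4 \<le> i" using assms by linarith
  then show ?thesis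
  proof cases
    case 1
    have "u \<in> V \<and> position u = 0 \<longleftrightarrow> u = a" for u
      using V_eq ends position_AB[of u] position_Q[of u] position_R[of u] by auto
    then have "{u \<in> V. position u = 0} = {a}" by auto
    then show ?thesis using 1 by simp
  next
    case 2
    have "u \<in> V \<and> position u = 1 \<longleftrightarrow> u \<in> A" for u
      using V_eq position_AB[of u] position_Q[of u] position_R[of u] k_pos by auto
    then have "{u \<in> V. position u = 1} = A" by auto
    then show ?thesis using 2 card_AB by simp
  next
    case 3
    have "u \<in> V \<and> position u = 2 \<longleftrightarrow> u \<in> B" for u
      using V_eq position_AB[of u] position_Q[of u] position_R[of u] k_pos by auto
    then have "{u \<in> V. position u = 2} = B" by auto
    then show ?thesis using 3 card_AB by simp
  next
    case 4
    have "u \<in> V \<and> position u = i \<longleftrightarrow> u \<in> Q \<and> d u b = i - 3" for u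
      using 4 V_eq position_AB[of u] position_Q[of u] position_R[of u] by auto
    then have "{u \<in> V. position u = i} = Q.level (i - 3)" by (auto simp: Q.level_def)
    moreover have "(i - 3) mod 4 \<le> 1 \<longleftrightarrow> i mod 4 = 0 \<or> i mod 4 = 3"
    proof -
      have "j mod 4 \<le> 1 \<longleftrightarrow> (j + 3) mod 4 = 0 \<or> (j + 3) mod 4 = 3" for j :: nat by presburger
      from this[of "i - 3"] show ?thesis using 4 by simp
    qed
    ultimately show ?thesis using card_Q_level[of "i - 3"] 4 by simp
  next
    case 5
    have mod4: "j mod 4 \<le> 1 \<longleftrightarrow> i mod 4 = 0 \<or> i mod 4 = 3" if "4 dvd i + j" for j
      using that by presburger
    have "u \<in> V \<and> position u = i \<longleftrightarrow> u \<in> R \<and> d u a = 2 * k + 4 - i" for u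
      using 5 assms V_eq position_AB[of u] position_Q[of u] position_R[of u] by auto
    then have "{u \<in> V. position u = i} = R.level (2 * k + 4 - i)" by (auto simp: R.level_def)
    then have card: "card {u \<in> V. position u = i} = (if (2 * k + 4 - i) mod 4 \<le> 1 then 1 else m)"
      using necklace.card_Q_level[OF swap, of "2 * k + 4 - i"] 5 by simp
    show ?thesis
    proof (cases "m = 1")
      case False
      \<comment> \<open>Levels of \<open>R\<close> are numbered against the direction of the
        positions; the residues still match because 4 divides the circumference.\<close>
      then have "4 dvd k" using period by blast
      moreover have "i + (2 * k + 4 - i) = 2 * k + 4" using assms by simp
      ultimately have "4 dvd i + (2 * k + 4 - i)" by simp
      then have "(2 * k + 4 - i) mod 4 \<le> 1 \<longleftrightarrow> i mod 4 = 0 \<or> i mod 4 = 3" by (rule mod4)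
      then show ?thesis using card by simp
    qed (use card in simp)
  qed
qed

end

section \<open>From a 2-cut to the circular structure\<close>

context short_cut
begin

text \<open>By \<open>crossing_d\<close> an edge from \<open>Eb\<close> to \<open>Ea\<close> joins
  \<open>Eb1\<close> to \<open>Ea1\<close>, and both are singletons.\<close>

lemma adj_Eb:
  assumes xy: "Eb1 = {x}" "Ea1 = {y}"
    and z: "z \<in> insert b Eb" and w: "adj z w"
  shows "w \<in> insert b Eb \<or> (z = b \<and> w \<in> B) \<or> (z = x \<and> w = y)"
proof (cases "z = b")
  case True
  have "w \<noteq> a" using adj_d[OF w] True d_ab d_sym[of a b] ab by auto
  moreover have "w \<notin> Ea"
  proof
    assume "w \<in> Ea"
    then have "d w a < d w b" "w \<in> E" by (auto simp: Ea_def)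
    moreover have "d w b = 1" using adj_d[OF adj_sym[OF w]] True by simp
    ultimately have "d w a = 0" by simp
    then show False using d_eq_0[of w a] \<open>w \<in> E\<close> ab disj by auto
  qed
  moreover have "w \<in> V" using adj_V w by blast
  moreover have "w \<in> D \<Longrightarrow> w \<in> B" using adj_sym[OF w] True by (simp add: B_def)
  ultimately show ?thesis using True V_eq E_split(1) by blast
next
  case False
  then have zE: "z \<in> Eb" "z \<in> E" "d z b < d z a" using z by (auto simp: Eb_def)
  have "w \<noteq> a"
  proof
    assume "w = a"
    then have "d z b = 0" using adj_d[OF w] zE by simp
    then show False using d_eq_0[of z b] zE ab disj by auto
  qed
  then consider "w = b" | "w \<in> Eb" | "w \<in> Ea" using E_closed[OF zE(2) w] E_split(1) by blast
  then show ?thesis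
  proof cases
    case 3
    have "z \<in> Eb1" "w \<in> Ea1"
      using crossing_d[OF zE(1) 3 w] zE(2) 3 by (auto simp: Eb1_def Ea1_def Ea_def)
    then show ?thesis using xy by blast
  qed auto
qed

text \<open>The mechanism of \<open>D_sum\<close> again: if \<open>z\<close> were closer than its
  neighbour \<open>w\<close> to both exits \<open>b\<close> and \<open>x\<close>, then all of
  \<open>V - Q\<close> would be closer to \<open>z\<close>, and this set exceeds half of
  \<open>V\<close> by \<open>card A\<close>. So the sum of the two distances propagates upwards from
  \<open>b\<close>.\<close>

lemma Eb_sum:
  assumes xy: "Eb1 = {x}" "Ea1 = {y}" and z: "z \<in> insert b Eb"
  shows "d z b + d z x = d x b"
proof -
  define Q where "Q = insert b Eb"
  have x: "x \<in> Eb" "x \<in> E" and y: "y \<in> Ea" "y \<in> E"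
    using xy by (auto simp: Eb1_def Ea1_def Eb_def Ea_def)
  have QV: "Q \<subseteq> V" "x \<in> V" "b \<in> V" "x \<in> Q" using x ab E_split(1) by (auto simp: Q_def)
  have adj_Q: "w \<in> Q \<or> (z = b \<and> w \<in> B) \<or> (z = x \<and> w = y)" if "z \<in> Q" "adj z w" for z w
    using adj_Eb[OF xy] that by (simp add: Q_def)
  have out: "\<exists>s\<in>{b, x}. d z p = d z s + d s p" if zp: "z \<in> Q" "p \<in> V - Q" for z p
  proof (cases "z = b \<or> z = x")
    case True
    then show ?thesis using d_eq_0[of z z] QV by auto
  next
    case False
    show ?thesis
      by (rule d_via_separator[of "Q - {b, x}"]) (use adj_Q False zp QV in \<open>blast+\<close>)
  qed
  have no_farther: "\<not> (d z b < d w b \<and> d z x < d w x)"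
    if zw: "z \<in> Q" "w \<in> Q" "adj z w" for z w
  proof
    assume f: "d z b < d w b \<and> d z x < d w x"
    have zV: "z \<in> V" "w \<in> V" using zw QV by auto
    have "2 * card (V - Q) \<le> card V"
    proof (rule card_ge_if_subset_closer[OF zw(3)])
      fix p assume p: "p \<in> V - Q"
      obtain s where s: "s \<in> {b, x}" "d w p = d w s + d s p" using out[OF zw(2) p] by blast
      have "d z p \<le> d z s + d s p" using d_triangle[of z s p] s(1) zV QV p by auto
      then show "d z p < d w p" using s f by auto
    qed auto
    moreover have "card Q = card Eb + 1" using disjoint E_split(4) by (simp add: Q_def)
    moreover have "card (V - Q) = card V - card Q"
      using QV finite_V by (intro card_Diff_subset) (auto intro: finite_subset)
    moreover have "1 \<le> card A" using A_nonempty AB(5) by (simp add: Suc_le_eq card_gt_0_iff)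
    ultimately show False using card_V card_equal by linarith
  qed
  have dy: "d y b = d x b + 1"
  proof -
    obtain p q where pq: "p \<in> Eb" "q \<in> Ea" "adj p q" using crossing by blast
    note c = crossing_d[OF pq]
    have "p \<in> Eb1" "q \<in> Ea1" using c pq by (auto simp: Eb1_def Ea1_def Eb_def Ea_def)
    then show ?thesis using c xy by auto
  qed
  have "d z b + d z x = d x b" if "z \<in> Q" for z
    using that
  proof (induction "d z b" arbitrary: z)
    case 0
    then have "z = b" using d_eq_0[of z b] QV by auto
    then show ?case using 0 d_sym[of b x] QV by simp
  next
    case (Suc n)
    have zV: "z \<in> V" "z \<noteq> b" using Suc QV d_eq_0[of b b] by auto
    then obtain w where w: "adj z w" "d z b = Suc (d w b)" using d_step[of z b] QV by blast
    have "\<not> (z = x \<and> w = y)" using w(2) dy by auto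
    then have wQ: "w \<in> Q" using adj_Q[OF Suc.prems w(1)] zV by blast
    have "d w b + d w x = d x b" using Suc.hyps(1)[OF _ wQ] Suc.hyps(2) w(2) by simp
    moreover have "d w x = Suc (d z x)"
      by (rule adj_cases[OF w(1) QV(2)])
        (use no_farther[OF wQ Suc.prems adj_sym[OF w(1)]] w(2) in auto)
    ultimately show ?case using w(2) by simp
  qed
  then show ?thesis using z by (simp add: Q_def)
qed

lemma necklace_exists:
  "\<exists>x y k. necklace V adj d A B (insert b Eb) (insert a Ea) a b x y k (card A)"
proof -
  obtain x y where xy: "Eb1 = {x}" "Ea1 = {y}"
    using complete_AB(1,2) by (auto simp: card_1_singleton_iff)
  have x: "x \<in> Eb" "x \<in> E" and y: "y \<in> Ea" "y \<in> E"
    using xy by (auto simp: Eb1_def Ea1_def Eb_def Ea_def)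
  obtain p q where pq: "p \<in> Eb" "q \<in> Ea" "adj p q" using crossing by blast
  note c = crossing_d[OF pq]
  have "p \<in> Eb1" "q \<in> Ea1" using c pq by (auto simp: Eb1_def Ea1_def Eb_def Ea_def)
  then have pq': "p = x" "q = y" using xy by auto
  have xy': "short_cut.Eb1 d b a E = {y}" "short_cut.Ea1 d b a E = {x}"
    using xy swap_defs1 by (simp_all add: Eb1_def short_cut.Ea1_def[OF swap])
  have V: "x \<in> V" "y \<in> V" "A \<subseteq> V" "B \<subseteq> V" using x y ab AB by auto
  have "necklace V adj d A B (insert b Eb) (insert a Ea) a b x y (d x b) (card A)"
  proof unfold_locales
    show "V = A \<union> B \<union> insert b Eb \<union> insert a Ea" using V_eq AB(1) E_split(1) by auto
    show "A \<inter> B = {}" by (rule AB(2))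
    show "A \<inter> insert b Eb = {}" "A \<inter> insert a Ea = {}" "B \<inter> insert b Eb = {}" "B \<inter> insert a Ea = {}"
      using disjoint by auto
    show "insert b Eb \<inter> insert a Ea = {}" using disjoint E_split(2) ab(3) by auto
    show "card A = card A" "card B = card A" using card_equal by simp_all
    show "1 \<le> card A" using A_nonempty AB(5) by (simp add: Suc_le_eq card_gt_0_iff)
    show "card (insert b Eb) = card (insert a Ea)" using disjoint E_split(3,4) card_equal by simp
    show "b \<in> insert b Eb" "x \<in> insert b Eb" "a \<in> insert a Ea" "y \<in> insert a Ea" using x y by auto
    show "adj u w \<longleftrightarrow> w = a \<or> w \<in> B" if "u \<in> A" for u w
      using that adj_AB[of u w] complete_AB(3)[of u w] by (auto simp: A_def)
    show "adj u w \<longleftrightarrow> w = b \<or> w \<in> A" if "u \<in> B" for u w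
      using that short_cut.adj_AB[OF swap, of u w] complete_AB(3)[of w u] adj_sym[of w u]
      unfolding swap_defs by (auto simp: B_def)
    show "w \<in> insert b Eb \<or> (z = b \<and> w \<in> B) \<or> (z = x \<and> w = y)"
      if "z \<in> insert b Eb" "adj z w" for z w by (rule adj_Eb[OF xy that])
    show "w \<in> insert a Ea \<or> (z = a \<and> w \<in> A) \<or> (z = y \<and> w = x)"
      if "z \<in> insert a Ea" "adj z w" for z w
      using short_cut.adj_Eb[OF swap xy', of z w] that unfolding swap_defs by blast
    show "adj x y" using pq pq' by simp
    show "d a b = 3" by (rule d_ab)
    show "d z b + d z x = d x b" if "z \<in> insert b Eb" for z by (rule Eb_sum[OF xy that])
    show "d z a + d z y = d x b" if "z \<in> insert a Ea" for z
      using short_cut.Eb_sum[OF swap xy', of z] that c(3) pq' unfolding swap_defs by simp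
    show "d b y = d x b + 1" using c pq' d_sym[of b y] V ab by simp
    show "d a x = d x b + 1" using c pq' d_sym[of a x] V ab by simp
    have "d x b \<noteq> 0" using d_eq_0[of x b] V ab x disj by auto
    then show "1 \<le> d x b" by simp
  qed
  then show ?thesis by blast
qed

end

context balanced_metric
begin

text \<open>A side that is not short has a neighbour \<open>u\<close> of a cut vertex
  \<open>p\<close> at distance 4 from the other one. It then contains all vertices closer to
  \<open>u\<close> than to \<open>p\<close>, hence at least half of \<open>V\<close>. This cannot
  happen on both sides, nor on a side no larger than the other, so some side is suitable as
  \<open>D\<close>.\<close>

lemma two_cut_circular:
  assumes ab: "a \<in> V" "b \<in> V" "d a b = 3"
    and C: "C \<noteq> {}" "C \<subset> V - {a, b}" "\<forall>p\<in>C. \<forall>q. adj p q \<longrightarrow> q \<in> C \<union> {a, b}"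
  shows "\<exists>k m pos. 1 \<le> k \<and> 1 \<le> m \<and> (m = 1 \<or> 4 dvd k) \<and> (\<forall>u\<in>V. pos u < 2 * k + 4) \<and>
    (\<forall>u\<in>V. \<forall>v\<in>V. adj u v \<longleftrightarrow> Suc (pos u) mod (2 * k + 4) = pos v \<or>
      Suc (pos v) mod (2 * k + 4) = pos u) \<and>
    (\<forall>i<2 * k + 4. card {u \<in> V. pos u = i} = (if i mod 4 = 0 \<or> i mod 4 = 3 then 1 else m))"
proof -
  define K where "K = V - {a, b} - C"
  have K: "K \<noteq> {}" "K \<subset> V - {a, b}" "C \<inter> K = {}" "V = {a, b} \<union> C \<union> K"
    using C(1,2) ab by (auto simp: K_def)
  have no: "\<not> adj u v" if "u \<in> C" "v \<in> K" for u v
    using C(3) that by (auto simp: K_def)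
  have a_b: "a \<noteq> b" using ab d_eq_0[of a a] by auto
  have fin: "finite C" "finite K" using K finite_V by (metis finite_Un)+
  have card: "card V = 2 + card C + card K"
  proof -
    have "card V = card ({a, b} \<union> C) + card K"
      unfolding K(4) using fin K(2,3) by (intro card_Un_disjoint) auto
    also have "card ({a, b} \<union> C) = card {a, b} + card C"
      using fin C(2) by (intro card_Un_disjoint) auto
    finally show ?thesis using a_b by simp
  qed
  have long: "card V \<le> 2 * card M"
    if "M \<subseteq> V - {p, q}" "u \<in> M" "adj u p" "d u q \<noteq> 2" "p \<in> V" "q \<in> V" "d p q = 3"
      "\<And>w v. w \<in> M \<Longrightarrow> adj w v \<Longrightarrow> v \<in> M \<union> {p, q}" for M p q u
  proof (rule card_le_if_closer_subset[OF that(3)])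
    have uV: "u \<in> V" using that by blast
    have "d u q = 4"
      by (rule adj_cases[OF that(3,6)]) (use that in auto)
    show "{z \<in> V. d u z < d p z} \<subseteq> M"
    proof
      fix z assume z: "z \<in> {z \<in> V. d u z < d p z}"
      show "z \<in> M"
      proof (rule ccontr)
        assume "z \<notin> M"
        have "\<exists>s\<in>{p, q}. d u z = d u s + d s z"
          by (rule d_via_separator[of M]) (use that z \<open>z \<notin> M\<close> in auto)
        moreover have "d p z \<le> d p q + d q z" using d_triangle that z by blast
        ultimately show False using z adj_d[OF that(3)] \<open>d u q = 4\<close> that by auto
      qed
    qed
    show "finite M" using that(1) finite_V finite_subset by blast
  qed
  define short where "short M \<longleftrightarrow> (\<forall>u\<in>M. adj u a \<longrightarrow> d u b = 2) \<and> (\<forall>u\<in>M. adj u b \<longrightarrow> d u a = 2)" for M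
  have half: "card V \<le> 2 * card M" if M: "\<not> short M" "M \<subseteq> V - {a, b}"
    "\<And>w v. w \<in> M \<Longrightarrow> adj w v \<Longrightarrow> v \<in> M \<union> {a, b}" for M
  proof -
    obtain u where u: "u \<in> M" "adj u a \<and> d u b \<noteq> 2 \<or> adj u b \<and> d u a \<noteq> 2"
      using M(1) by (auto simp: short_def)
    have "d b a = 3" using ab d_sym by simp
    have "\<And>w v. w \<in> M \<Longrightarrow> adj w v \<Longrightarrow> v \<in> M \<union> {b, a}" using M(3) by blast
    then show ?thesis
      using u(2) long[of M a b u] long[of M b a u] M(2,3) u(1) ab \<open>d b a = 3\<close> by blast
  qed
  have cutI: "short_cut V adj d a b D E"
    if "short D" "card V \<le> 2 * card E + 2" "V = {a, b} \<union> D \<union> E" "D \<inter> E = {}" "D \<noteq> {}" "E \<noteq> {}"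
      "D \<subseteq> V - {a, b}" "E \<subseteq> V - {a, b}" "\<And>u v. u \<in> D \<Longrightarrow> v \<in> E \<Longrightarrow> \<not> adj u v" for D E
    using that ab by unfold_locales (auto simp: short_def)
  have no': "\<not> adj u v" if "u \<in> K" "v \<in> C" for u v using no that adj_sym by blast
  have K_closed: "v \<in> K \<union> {a, b}" if "w \<in> K" "adj w v" for w v
    using that no'[of w v] adj_V[of w v] K(4) by blast
  have K4: "V = {a, b} \<union> K \<union> C" using K(4) by blast
  have CK: "short_cut V adj d a b C K" if "short C" "card V \<le> 2 * card K + 2"
    using that K C(1,2) no by (intro cutI) auto
  have KC: "short_cut V adj d a b K C" if "short K" "card V \<le> 2 * card C + 2"
    by (rule cutI[OF that K4]) (use K C(1,2) no' in auto)
  have hC: "\<not> short C \<Longrightarrow> card V \<le> 2 * card C" using half[of C] C by blast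
  have hK: "\<not> short K \<Longrightarrow> card V \<le> 2 * card K" using half[of K] K(2) K_closed by blast
  have "\<exists>D E. short_cut V adj d a b D E"
  proof (cases "short C \<and> card V \<le> 2 * card K + 2")
    case True
    then show ?thesis using CK by blast
  next
    case False
    then have "card V \<le> 2 * card C + 2" using hC card by linarith
    moreover have "short K" using False hC hK card by linarith
    ultimately show ?thesis using KC by blast
  qed
  then obtain D E where "short_cut V adj d a b D E" by blast
  from short_cut.necklace_exists[OF this] obtain A B Q R x y k m
    where "necklace V adj d A B Q R a b x y k m" by blast
  then interpret necklace V adj d A B Q R a b x y k m .
  show ?thesis
    using k_pos card_AB(3) period position_less adj_iff_position card_position by blast
qed

end

section \<open>Passage from library digraphs to the metric setting\<close>

text \<open>The natural number behind \<open>gdist\<close>, with which it agrees for reachable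
  pairs.\<close>

definition walk_dist :: "('a, 'b) pre_digraph \<Rightarrow> 'a \<Rightarrow> 'a \<Rightarrow> nat" where
  "walk_dist G u v = (LEAST n. \<exists>p. pre_digraph.awalk G u p v \<and> length p = n)"

context graph
begin

lemma walk_dist_le: "awalk u p v \<Longrightarrow> walk_dist G u v \<le> length p"
  unfolding walk_dist_def by (intro Least_le) blast

lemma walk_dist_attained:
  assumes "u \<rightarrow>\<^sup>* v"
  obtains p where "awalk u p v" "length p = walk_dist G u v"
proof -
  obtain q where "awalk u q v" using assms by (auto simp: reachable_awalk)
  then have "\<exists>n p. awalk u p v \<and> length p = n" by blast
  then have "\<exists>p. awalk u p v \<and> length p = walk_dist G u v"
    unfolding walk_dist_def by (rule LeastI_ex)
  then show ?thesis using that by blast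
qed

lemma dominates_awalk:
  assumes "u \<rightarrow> v"
  obtains e where "awalk u [e] v"
proof -
  obtain e where "e \<in> arcs G" "tail G e = u" "head G e = v"
    using assms by (auto simp: arcs_ends_def arc_to_ends_def)
  then have "awalk u [e] v" by (auto simp: awalk_simps)
  then show ?thesis using that by blast
qed

lemma awalk_reverse: "awalk u p v \<Longrightarrow> \<exists>q. awalk v q u \<and> length q = length p"
proof (induction p arbitrary: u)
  case Nil
  then show ?case by (auto simp: awalk_Nil_iff intro: exI[of _ "[]"])
next
  case (Cons e p)
  then have e: "e \<in> arcs G" "tail G e = u" "awalk (head G e) p v" by (auto simp: awalk_Cons_iff)
  then obtain q where q: "awalk v q (head G e)" "length q = length p" using Cons by blast
  have "u \<rightarrow> head G e" using e by (auto simp: arcs_ends_def arc_to_ends_def)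
  then have "head G e \<rightarrow> u" using sym_arcs by (auto simp: symmetric_def dest: symD)
  then obtain e' where "awalk (head G e) [e'] u" by (rule dominates_awalk)
  then have "awalk v (q @ [e']) u" using q by (blast intro: awalk_appendI)
  then show ?case using q by (intro exI[of _ "q @ [e']"]) simp
qed

lemma gdist_walk_dist: "u \<rightarrow>\<^sup>* v \<Longrightarrow> gdist G u v = ereal (real (walk_dist G u v))"
  unfolding walk_dist_def by (rule gdist_eq_Least_length[OF wf_digraph])

lemma balanced_metric_walk_dist:
  assumes bip: "bipartite G" and db: "distance_balanced G"
  shows "balanced_metric (verts G) (\<lambda>u v. u \<rightarrow> v) (walk_dist G)"
proof
  have "strongly_connected (mk_symmetric G)"
    using db by (simp add: distance_balanced_def Digraph_Component.connected_def)
  then have reach: "u \<rightarrow>\<^sup>* v" if "u \<in> verts G" "v \<in> verts G" for u v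
    using that reachable_mk_symmetric_eq[OF sym_arcs] by (auto simp: strongly_connected_def)
  obtain X Y where XY: "verts G = X \<union> Y" "X \<inter> Y = {}" "arcs_ends G \<subseteq> X \<times> Y \<union> Y \<times> X"
    using bip by (auto simp: bipartite_def)
  \<comment> \<open>The two colour classes determine the parity of every walk; this is what makes
    the distances from adjacent vertices differ.\<close>
  have par: "even (length p) \<longleftrightarrow> (u \<in> X \<longleftrightarrow> v \<in> X)" if "awalk u p v" for u p v
    using that
  proof (induction p arbitrary: u)
    case Nil
    then show ?case by (auto simp: awalk_Nil_iff)
  next
    case (Cons e p)
    then have e: "e \<in> arcs G" "tail G e = u" "awalk (head G e) p v" by (auto simp: awalk_Cons_iff)
    then have "(u, head G e) \<in> arcs_ends G" by (auto simp: arcs_ends_def arc_to_ends_def)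
    then have "u \<in> X \<longleftrightarrow> head G e \<notin> X" using XY by auto
    then show ?case using Cons.IH[OF e(3)] by auto
  qed
  show "finite (verts G)" by simp
  show in_verts: "u \<in> verts G \<and> v \<in> verts G" if "u \<rightarrow> v" for u v
    using that by (auto simp: adj_in_verts)
  show zero: "walk_dist G u v = 0 \<longleftrightarrow> u = v" if uv: "u \<in> verts G" "v \<in> verts G" for u v
  proof
    assume "walk_dist G u v = 0"
    moreover obtain p where "awalk u p v" "length p = walk_dist G u v"
      using walk_dist_attained[OF reach[OF uv]] .
    ultimately show "u = v" by (simp add: awalk_Nil_iff)
  next
    assume "u = v"
    then have "awalk u [] v" using uv by (simp add: awalk_Nil_iff)
    then show "walk_dist G u v = 0" using walk_dist_le[of u "[]" v] by simp
  qed
  have sym_le: "walk_dist G u v \<le> walk_dist G v u" if uv: "u \<in> verts G" "v \<in> verts G" for u v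
  proof -
    obtain p where "awalk v p u" "length p = walk_dist G v u"
      using walk_dist_attained[OF reach[OF uv(2,1)]] .
    then show ?thesis using awalk_reverse[of v p u] walk_dist_le by metis
  qed
  show "walk_dist G u v = walk_dist G v u" if "u \<in> verts G" "v \<in> verts G" for u v
    using sym_le that by (simp add: le_antisym)
  show tri: "walk_dist G u w \<le> walk_dist G u v + walk_dist G v w"
    if uvw: "u \<in> verts G" "v \<in> verts G" "w \<in> verts G" for u v w
  proof -
    obtain p where p: "awalk u p v" "length p = walk_dist G u v"
      using walk_dist_attained[OF reach[OF uvw(1,2)]] .
    obtain q where q: "awalk v q w" "length q = walk_dist G v w"
      using walk_dist_attained[OF reach[OF uvw(2,3)]] .
    have "awalk u (p @ q) w" using p q by (blast intro: awalk_appendI)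
    then have "walk_dist G u w \<le> length (p @ q)" by (rule walk_dist_le)
    then show ?thesis using p q by simp
  qed
  \<comment> \<open>The clause for \<open>n = 0\<close> identifies the first step with
    \<open>v\<close>, so that distance 1 implies adjacency.\<close>
  have first: "\<exists>w. u \<rightarrow> w \<and> w \<in> verts G \<and> walk_dist G w v \<le> n \<and> (n = 0 \<longrightarrow> w = v)"
    if uv: "u \<in> verts G" "v \<in> verts G" and n: "walk_dist G u v = Suc n" for u v n
  proof -
    obtain p where p: "awalk u p v" "length p = Suc n"
      using walk_dist_attained[OF reach[OF uv]] n by metis
    then obtain e q where eq: "p = e # q" by (cases p) auto
    then have e: "e \<in> arcs G" "tail G e = u" "awalk (head G e) q v" "length q = n"
      using p by (auto simp: awalk_Cons_iff)
    then have "u \<rightarrow> head G e" by (auto simp: arcs_ends_def arc_to_ends_def)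
    moreover have "walk_dist G (head G e) v \<le> n" using walk_dist_le[OF e(3)] e(4) by simp
    moreover have "n = 0 \<longrightarrow> head G e = v" using e(3,4) by (auto simp: awalk_Nil_iff)
    ultimately show ?thesis using in_verts by blast
  qed
  have one: "walk_dist G u v \<le> 1" if uv: "u \<rightarrow> v" for u v
  proof -
    obtain e where "awalk u [e] v" using dominates_awalk[OF uv] .
    then show ?thesis using walk_dist_le[of u "[e]" v] by simp
  qed
  show "walk_dist G u v = 1 \<longleftrightarrow> u \<rightarrow> v" if uv: "u \<in> verts G" "v \<in> verts G" for u v
  proof
    assume "walk_dist G u v = 1"
    then show "u \<rightarrow> v" using first[OF uv, of 0] by auto
  next
    assume e: "u \<rightarrow> v"
    then have "u \<noteq> v" using adj_not_same by blast
    then have "walk_dist G u v \<noteq> 0" using zero[OF uv] by simp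
    then show "walk_dist G u v = 1" using one[OF e] by linarith
  qed
  show "\<exists>w. u \<rightarrow> w \<and> walk_dist G u v = Suc (walk_dist G w v)"
    if uv: "u \<in> verts G" "v \<in> verts G" "u \<noteq> v" for u v
  proof -
    obtain n where n: "walk_dist G u v = Suc n" using zero[OF uv(1,2)] uv(3) by (cases "walk_dist G u v") auto
    obtain w where w: "u \<rightarrow> w" "w \<in> verts G" "walk_dist G w v \<le> n" using first[OF uv(1,2) n] by blast
    have "walk_dist G u v \<le> 1 + walk_dist G w v"
      using tri[OF uv(1) w(2) uv(2)] one[OF w(1)] by linarith
    then show ?thesis using w n by (intro exI[of _ w]) simp
  qed
  show "walk_dist G u z \<noteq> walk_dist G v z" if uv: "u \<rightarrow> v" and z: "z \<in> verts G" for u v z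
  proof -
    have V: "u \<in> verts G" "v \<in> verts G" using in_verts uv by blast+
    obtain p where p: "awalk u p z" "length p = walk_dist G u z"
      using walk_dist_attained[OF reach[OF V(1) z]] .
    obtain q where q: "awalk v q z" "length q = walk_dist G v z"
      using walk_dist_attained[OF reach[OF V(2) z]] .
    obtain e where "awalk u [e] v" using dominates_awalk[OF uv] .
    then have "u \<in> X \<longleftrightarrow> v \<notin> X" using par[of u "[e]" v] by simp
    then show ?thesis using par[OF p(1)] par[OF q(1)] p(2) q(2) by auto
  qed
  show "card {z \<in> verts G. walk_dist G u z < walk_dist G v z} =
      card {z \<in> verts G. walk_dist G v z < walk_dist G u z}" if uv: "u \<rightarrow> v" for u v
  proof -
    have closer: "closer_set G p q = {z \<in> verts G. walk_dist G p z < walk_dist G q z}"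
      if "p \<in> verts G" "q \<in> verts G" for p q
      using that reach gdist_walk_dist by (auto simp: closer_set_def)
    have "card (closer_set G u v) = card (closer_set G v u)"
      using db uv unfolding distance_balanced_def by blast
    then show ?thesis using closer[of u v] closer[of v u] in_verts[OF uv] by simp
  qed
qed

text \<open>Two vertices \<open>u\<close>, \<open>v\<close> witness that the rest is disconnected;
  the part reachable from \<open>u\<close> without meeting \<open>S\<close> is closed up to
  \<open>S\<close> and misses \<open>v\<close>.\<close>

lemma two_cut_closed_set:
  assumes "two_cut G S"
  obtains C where "C \<noteq> {}" "C \<subset> verts G - S"
    "\<forall>p\<in>C. \<forall>q. p \<rightarrow> q \<longrightarrow> q \<in> C \<union> S"
proof -
  define W where "W = verts G - S"
  define H where "H = mk_symmetric (G \<restriction> W)"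
  have "\<not> strongly_connected H" "W \<noteq> {}"
    using assms by (auto simp: two_cut_def W_def H_def Digraph_Component.connected_def)
  then obtain u v where uv: "u \<in> W" "v \<in> W" "\<not> u \<rightarrow>\<^sup>*\<^bsub>H\<^esub> v"
    by (auto simp: strongly_connected_def H_def)
  interpret GW: wf_digraph "G \<restriction> W" by (rule wellformed_induce_subgraph)
  interpret H: pair_wf_digraph H unfolding H_def by (rule GW.wellformed_mk_symmetric)
  define C where "C = {w \<in> W. u \<rightarrow>\<^sup>*\<^bsub>H\<^esub> w}"
  show ?thesis
  proof
    have "u \<in> pverts H" using uv by (simp add: H_def)
    then have "u \<rightarrow>\<^sup>*\<^bsub>H\<^esub> u" by (rule H.reachable_refl)
    then show "C \<noteq> {}" using uv by (auto simp: C_def)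
    show "C \<subset> verts G - S" using uv by (auto simp: C_def W_def)
    have "q \<in> C \<union> S" if p: "p \<in> C" and pq: "p \<rightarrow> q" for p q
    proof (rule ccontr)
      assume n: "q \<notin> C \<union> S"
      have qW: "q \<in> W" using n pq by (auto simp: W_def adj_in_verts)
      obtain e where e: "e \<in> arcs G" "tail G e = p" "head G e = q"
        using pq by (auto simp: arcs_ends_def arc_to_ends_def)
      have "p \<in> W" using p by (simp add: C_def)
      then have "e \<in> arcs (G \<restriction> W)" using e qW by (simp add: induce_subgraph_def)
      then have arc: "(p, q) \<in> parcs H"
        using e(2,3) unfolding H_def parcs_mk_symmetric by (intro UN_I[of e]) simp_all
      have "u \<rightarrow>\<^sup>*\<^bsub>H\<^esub> p" using p by (simp add: C_def)
      then have "u \<rightarrow>\<^sup>*\<^bsub>H\<^esub> q" using arc by (rule H.reachable_adj_trans)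
      then show False using n qW by (simp add: C_def)
    qed
    then show "\<forall>p\<in>C. \<forall>q. p \<rightarrow> q \<longrightarrow> q \<in> C \<union> S" by blast
  qed
qed

text \<open>Arcs of \<open>G\<close> are arbitrary objects, whereas those of \<open>H\<close> are
  pairs; the absence of parallel arcs makes the map from an arc to the image of its end points
  injective.\<close>

lemma digraph_iso_with_projI:
  assumes f: "bij_betw f (verts G) (pverts H)"
    and H: "parcs H \<subseteq> pverts H \<times> pverts H"
    and iff: "\<And>u v. u \<in> verts G \<Longrightarrow> v \<in> verts G \<Longrightarrow> u \<rightarrow> v \<longleftrightarrow> (f u, f v) \<in> parcs H"
  shows "digraph_iso G (with_proj H)"
proof -
  define h where "h = \<lparr> iso_verts = f, iso_arcs = (\<lambda>e. (f (tail G e), f (head G e))),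
    iso_head = snd, iso_tail = fst \<rparr>"
  have inj: "inj_on f (verts G)" and im: "f ` verts G = pverts H"
    using f by (auto simp: bij_betw_def)
  have "digraph_isomorphism h"
    unfolding digraph_isomorphism_def
  proof (intro conjI)
    show "inj_on (iso_arcs h) (arcs G)"
    proof (rule inj_onI)
      fix e e' assume e: "e \<in> arcs G" "e' \<in> arcs G" "iso_arcs h e = iso_arcs h e'"
      then have "tail G e = tail G e'" "head G e = head G e'"
        using inj by (auto simp: h_def inj_on_def)
      then show "e = e'" using no_multi_arcs e by (auto simp: arc_to_ends_def)
    qed
  qed (use inj wf_digraph in \<open>auto simp: h_def\<close>)
  moreover have "with_proj H = app_iso h G"
  proof -
    have "(\<lambda>e. (f (tail G e), f (head G e))) ` arcs G = parcs H"
    proof (intro equalityI subsetI)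
      fix p assume "p \<in> (\<lambda>e. (f (tail G e), f (head G e))) ` arcs G"
      then obtain e where e: "e \<in> arcs G" "p = (f (tail G e), f (head G e))" by blast
      then have "tail G e \<rightarrow> head G e" by (auto simp: arcs_ends_def arc_to_ends_def)
      then show "p \<in> parcs H" using iff e by auto
    next
      fix p assume p: "p \<in> parcs H"
      then have "p \<in> f ` verts G \<times> f ` verts G" using H unfolding im by (rule subsetD[rotated])
      then obtain u v where uv: "u \<in> verts G" "v \<in> verts G" "p = (f u, f v)" by blast
      then have "u \<rightarrow> v" using iff p by blast
      then obtain e where "e \<in> arcs G" "tail G e = u" "head G e = v"
        by (auto simp: arcs_ends_def arc_to_ends_def)
      then show "p \<in> (\<lambda>e. (f (tail G e), f (head G e))) ` arcs G" using uv by force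
    qed
    then show ?thesis using im by (simp add: app_iso_def h_def with_proj_def)
  qed
  ultimately show ?thesis by (auto simp: digraph_iso_def)
qed

end

lemma cong_succ_iff:
  assumes "i < n" "j < n"
  shows "[int j - int i = 1] (mod int n) \<longleftrightarrow> Suc i mod n = j"
proof -
  have "[int j - int i = 1] (mod int n) \<longleftrightarrow> [int j = int (Suc i)] (mod int n)"
    by (metis add.commute add_diff_cancel_right' cong_add_lcancel diff_add_cancel of_nat_Suc)
  also have "\<dots> \<longleftrightarrow> [j = Suc i] (mod n)" by (rule cong_int_iff)
  also have "\<dots> \<longleftrightarrow> Suc i mod n = j" using assms by (auto simp: cong_def)
  finally show ?thesis .
qed

theorem theorem3p7:
  fixes G :: "('a, 'b) pre_digraph"
  assumes "graph G"
    and "bipartite G"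
    and "distance_balanced G"
    and "\<exists>a b. two_cut G {a, b} \<and> gdist G a b = 3"
  shows "is_cycle_graph G \<or>
    (\<exists>m l. m \<ge> 2 \<and> l \<ge> 3 \<and> odd l \<and> digraph_iso G (with_proj (W_graph m l)))"
proof -
  interpret graph G by fact
  interpret balanced_metric "verts G" "\<lambda>u v. u \<rightarrow>\<^bsub>G\<^esub> v" "walk_dist G"
    using assms(2,3) by (rule balanced_metric_walk_dist)
  obtain a b where cut: "two_cut G {a, b}" and dist: "gdist G a b = 3" using assms(4) by blast
  have V: "a \<in> verts G" "b \<in> verts G" using cut by (auto simp: two_cut_def)
  have "strongly_connected (mk_symmetric G)"
    using assms(3) by (simp add: distance_balanced_def Digraph_Component.connected_def)
  then have "a \<rightarrow>\<^sup>*\<^bsub>G\<^esub> b"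
    using V reachable_mk_symmetric_eq[OF sym_arcs] by (auto simp: strongly_connected_def)
  then have "ereal (real (walk_dist G a b)) = ereal 3" using gdist_walk_dist dist by simp
  then have d_ab: "walk_dist G a b = 3" by simp
  obtain C where C: "C \<noteq> {}" "C \<subset> verts G - {a, b}"
    "\<forall>p\<in>C. \<forall>q. p \<rightarrow>\<^bsub>G\<^esub> q \<longrightarrow> q \<in> C \<union> {a, b}"
    using two_cut_closed_set[OF cut] .
  obtain k m pos where k: "1 \<le> k" and m: "1 \<le> m" and period: "m = 1 \<or> 4 dvd k"
    and pos_less: "\<forall>u\<in>verts G. pos u < 2 * k + 4"
    and adj: "\<forall>u\<in>verts G. \<forall>v\<in>verts G. u \<rightarrow>\<^bsub>G\<^esub> v \<longleftrightarrow> Suc (pos u) mod (2 * k + 4) = pos v \<or>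
      Suc (pos v) mod (2 * k + 4) = pos u"
    and layers: "\<forall>i<2 * k + 4. card {u \<in> verts G. pos u = i} =
      (if i mod 4 = 0 \<or> i mod 4 = 3 then 1 else m)"
    using two_cut_circular[OF V d_ab C] by (elim exE conjE) (rule that)
  define L where "L = 2 * k + 4"
  have cong: "u \<rightarrow>\<^bsub>G\<^esub> v \<longleftrightarrow>
      [int (pos v) - int (pos u) = 1] (mod int L) \<or> [int (pos v) - int (pos u) = -1] (mod int L)"
    if "u \<in> verts G" "v \<in> verts G" for u v
    using that adj pos_less cong_succ_iff[of "pos u" L "pos v"] cong_succ_iff[of "pos v" L "pos u"]
    by (simp add: L_def cong_diff_swap_iff)
  show ?thesis
  proof (cases "m = 1")
    case True
    \<comment> \<open>Every position is occupied exactly once, so the position itself is the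
      isomorphism to a cycle.\<close>
    then have single: "card {u \<in> verts G. pos u = i} = 1" if "i < L" for i
      using that layers by (simp add: L_def)
    have "bij_betw pos (verts G) {0..<L}"
      unfolding bij_betw_def
    proof (intro conjI equalityI subsetI inj_onI)
      fix u v assume uv: "u \<in> verts G" "v \<in> verts G" "pos u = pos v"
      then have "card {w \<in> verts G. pos w = pos u} = 1" using single pos_less by (simp add: L_def)
      then obtain w where "{w \<in> verts G. pos w = pos u} = {w}" by (auto simp: card_1_singleton_iff)
      moreover have "u \<in> {w \<in> verts G. pos w = pos u}" "v \<in> {w \<in> verts G. pos w = pos u}"
        using uv by auto
      ultimately show "u = v" by (metis singletonD)
    next
      fix i assume "i \<in> {0..<L}"
      then have "card {u \<in> verts G. pos u = i} = 1" by (intro single) simp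
      then have "{u \<in> verts G. pos u = i} \<noteq> {}" by (metis card.empty zero_neq_one)
      then show "i \<in> pos ` verts G" by blast
    qed (use pos_less in \<open>auto simp: L_def\<close>)
    then have "digraph_iso G (with_proj (cycle_graph L))"
      using cong pos_less by (intro digraph_iso_with_projI[of pos]) (auto simp: cycle_graph_def L_def)
    then show ?thesis unfolding is_cycle_graph_def by (intro disjI1 exI[of _ L]) (simp add: L_def)
  next
    case False
    then obtain c where c: "k = 4 * c" using period by blast
    \<comment> \<open>The circumference is \<open>8 * c + 4 = 4 * (2 * c + 1)\<close>, and
      \<open>k \<ge> 1\<close> gives \<open>c \<ge> 1\<close>; hence \<open>l\<close> is odd and at
      least 3.\<close>
    define l where "l = 2 * c + 1"
    have L: "L = 4 * l" using c by (simp add: L_def l_def)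
    define P where "P i = {u \<in> verts G. pos u = i}" for i
    have "\<exists>g. bij_betw g (P i) {1..W_layer m i}" if "i < L" for i
    proof -
      have "card (P i) = card {1..W_layer m i}"
        using layers that by (simp add: P_def L_def W_layer_def cong_def)
      then show ?thesis by (intro finite_same_card_bij) (simp_all add: P_def)
    qed
    \<comment> \<open>Each layer may be numbered arbitrarily, since adjacency depends only on the
      positions.\<close>
    then obtain g where g: "\<And>i. i < L \<Longrightarrow> bij_betw (g i) (P i) {1..W_layer m i}" by metis
    define f where "f u = (pos u, g (pos u) u)" for u
    have "bij_betw f (verts G) (W_verts m l)"
      unfolding bij_betw_def
    proof (intro conjI equalityI subsetI inj_onI)
      fix u v assume uv: "u \<in> verts G" "v \<in> verts G" "f u = f v"
      then have "pos u < L" "pos u = pos v" "g (pos u) u = g (pos u) v" "u \<in> P (pos u)" "v \<in> P (pos u)"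
        using pos_less by (auto simp: f_def L_def P_def)
      then show "u = v" using g[of "pos u"] by (auto simp: bij_betw_def inj_on_def)
    next
      fix p assume "p \<in> f ` verts G"
      then obtain u where u: "u \<in> verts G" "p = f u" by blast
      then have "pos u < L" "u \<in> P (pos u)" using pos_less by (auto simp: L_def P_def)
      then have "g (pos u) u \<in> {1..W_layer m (pos u)}" using g[of "pos u"] by (auto simp: bij_betw_def)
      then show "p \<in> W_verts m l" using u \<open>pos u < L\<close> L by (simp add: f_def W_verts_def)
    next
      fix p assume "p \<in> W_verts m l"
      then obtain i j where ij: "p = (i, j)" "i < L" "j \<in> {1..W_layer m i}"
        using L by (auto simp: W_verts_def)
      then obtain u where "u \<in> P i" "g i u = j" using g[of i] by (metis bij_betw_def imageE)
      then show "p \<in> f ` verts G" using ij by (auto simp: P_def f_def)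
    qed
    moreover from this have "f u \<in> W_verts m l" if "u \<in> verts G" for u
      using that by (auto simp: bij_betw_def)
    ultimately have "digraph_iso G (with_proj (W_graph m l))"
      using cong L by (intro digraph_iso_with_projI[of f]) (auto simp: W_graph_def f_def)
    moreover have "m \<ge> 2" "l \<ge> 3" "odd l" using False m k c by (auto simp: l_def)
    ultimately show ?thesis by blast
  qed
qed

end
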